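(* Assume the following hypothesis (H): for every $\theta>0$ there is $x_0(\theta)$ such that for every real $x\ge x_0(\theta)$ the interval $[x,x+x^\theta]$ contains a prime number. Then there is an absolute constant $c>0$ with the following property. For every $0<\rho_0<1$ there exist real numbers $0<\rho_1<\rho_0$ and $0<d<1$, and infinitely many primes $q$, such that: whenever $S\subseteq \mathbb{Z}/q\mathbb{Z}$ satisfies $|S|\ge \rho_1 q$ and $\mu_q(S)=r_q(\rho_1)$ (i.e. $S$ has the least number of $3$-term arithmetic progressions modulo $q$ among all subsets of $\mathbb{Z}/q\mathbb{Z}$ of density at least $\rho_1$), there exists an integer $1\le b\le q-1$ such that $$|S\cap (S+bj)|\ \ge\ |S|\left(1-\frac{c}{|\log \rho_1|}\right)\quad\text{for every integer } 0\le j\le q^d,$$ where $S+bj=\{s+bj \bmod q : s\in S\}$.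
   Context: For a positive integer $n$ and $T\subseteq \mathbb{Z}/n\mathbb{Z}$, $\mu_n(T)=\#\{(a,b,c)\in T^3 : a+b\equiv 2c \pmod n\}/n^2$ (ordered triples, trivial ones $a=b=c$ included). For $0<\rho\le 1$ and $q$ a positive integer, $r_q(\rho)=\min\{\mu_q(S): S\subseteq \mathbb{Z}/q\mathbb{Z},\ |S|\ge \rho q\}$. A subset $S$ of $\mathbb{Z}/q\mathbb{Z}$ has density at least $\rho$ if $|S|\ge\rho q$. *)

theory Defs
  imports "HOL-Analysis.Analysis" "HOL-Computational_Algebra.Primes"
begin

text \<open>Z/nZ is represented by the residues {0..<n} (natural numbers), with arithmetic mod n.\<close>

definition ap3_count :: "nat \<Rightarrow> nat set \<Rightarrow> nat" where
  "ap3_count n T = card {(a,b,c). a \<in> T \<and> b \<in> T \<and> c \<in> T \<and> (a + b) mod n = (2 * c) mod n}"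

definition mu :: "nat \<Rightarrow> nat set \<Rightarrow> real" where
  "mu n T = real (ap3_count n T) / (real n)^2"

definition r_min :: "nat \<Rightarrow> real \<Rightarrow> real" where
  "r_min q \<rho> = Min {mu q S | S. S \<subseteq> {0..<q} \<and> real (card S) \<ge> \<rho> * real q}"

definition shift_mod :: "nat \<Rightarrow> nat set \<Rightarrow> nat \<Rightarrow> nat set" where
  "shift_mod q S t = (\<lambda>s. (s + t) mod q) ` S"

end

theory Submission
  imports Defs
begin

text \<open>Write \<open>\<rho>\<^sub>i = exp (-\<surd>i)\<close>. Behrend's construction gives \<open>r_min q \<rho>\<^sub>i \<le> exp (-c i)\<close>, while
  Varnavides' theorem bounds \<open>r_min q \<rho>\<^sub>i\<close> below independently of \<open>q\<close>. Hence for each large odd \<open>q\<close> some \<open>i\<close>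
  in a range independent of \<open>q\<close> satisfies \<open>r_min q \<rho>\<^sub>j \<ge> r_min q \<rho>\<^sub>i * exp (c' (i - j))\<close> for all \<open>j \<le> i\<close>; by pigeonhole
  one \<open>i\<close> serves infinitely many primes.

  Let \<open>S\<close> be a minimiser for \<open>\<rho>\<^sub>i\<close>, put \<open>L = \<bar>ln \<rho>\<^sub>i\<bar> = \<surd>i\<close>, and let \<open>f\<close> be the average of the indicator of \<open>S\<close> over a
  progression of length about \<open>q powr d\<close> whose step is chosen by Dirichlet's theorem so that averaging hardly
  changes the large Fourier coefficients. Then \<open>f\<close> has at most about as many progressions as \<open>S\<close>, so its level sets
  \<open>{f \<ge> 1/2^k}\<close> have few progressions, and the growth condition forces their densities to be at most
  \<open>\<rho>\<^sub>i * exp (O(k / L))\<close>. Summing over \<open>k\<close> shows \<open>\<Sum> f\<^sup>2 \<ge> \<bar>S\<bar> * (1 - O(1 / L))\<close>, which says that \<open>S\<close> is almost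
  invariant under most multiples of the step, hence under all of them by subadditivity.\<close>

section \<open>Fourier analysis modulo q\<close>

definition ee :: "int \<Rightarrow> int \<Rightarrow> complex" where
  "ee q x = cis (2 * pi * real_of_int x / real_of_int q)"

text \<open>Functions on Z/qZ live on all of \<open>int\<close>, so that translates such as
  \<open>f (z - t)\<close> need no reduction modulo \<open>q\<close>.\<close>

definition periodic :: "int \<Rightarrow> (int \<Rightarrow> 'a) \<Rightarrow> bool" where
  "periodic q f \<longleftrightarrow> (\<forall>x. f (x mod q) = f x)"

lemma periodicD: "periodic q f \<Longrightarrow> x mod q = y mod q \<Longrightarrow> f x = f y"
  unfolding periodic_def by metis

lemma periodicI: "(\<And>x y. x mod q = y mod q \<Longrightarrow> f x = f y) \<Longrightarrow> periodic q f"
  unfolding periodic_def by (metis mod_mod_trivial)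

text \<open>An injective self-map of the residues is a permutation. Translation, reflection and
  doubling are the instances below.\<close>

lemma sum_reindex_mod:
  fixes F :: "int \<Rightarrow> 'a::comm_monoid_add"
  assumes q: "q > 0" and F: "periodic q F" and inj: "inj_on (\<lambda>x. \<phi> x mod q) {0..<q}"
  shows "(\<Sum>x\<in>{0..<q}. F (\<phi> x)) = (\<Sum>x\<in>{0..<q}. F x)"
proof -
  have "(\<lambda>x. \<phi> x mod q) ` {0..<q} = {0..<q}"
    by (rule endo_inj_surj) (use q inj in auto)
  then have "bij_betw (\<lambda>x. \<phi> x mod q) {0..<q} {0..<q}"
    using inj by (simp add: bij_betw_def)
  from sum.reindex_bij_betw[OF this, of F] show ?thesis
    using F by (simp add: periodic_def)
qed

lemma sum_shift_mod:
  fixes F :: "int \<Rightarrow> 'a::comm_monoid_add"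
  assumes q: "q > 0" and F: "periodic q F"
  shows "(\<Sum>x\<in>{0..<q}. F (x + a)) = (\<Sum>x\<in>{0..<q}. F x)"
proof (rule sum_reindex_mod[OF q F], rule inj_onI)
  fix x y assume xy: "x \<in> {0..<q}" "y \<in> {0..<q}" "(x + a) mod q = (y + a) mod q"
  then have "q dvd (x - y)" by (simp add: mod_eq_dvd_iff)
  then show "x = y" using xy by (simp add: mod_eq_dvd_iff[symmetric])
qed

lemma sum_reflect_mod:
  fixes F :: "int \<Rightarrow> 'a::comm_monoid_add"
  assumes q: "q > 0" and F: "periodic q F"
  shows "(\<Sum>x\<in>{0..<q}. F (a - x)) = (\<Sum>x\<in>{0..<q}. F x)"
proof (rule sum_reindex_mod[OF q F], rule inj_onI)
  fix x y assume xy: "x \<in> {0..<q}" "y \<in> {0..<q}" "(a - x) mod q = (a - y) mod q"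
  then have "q dvd (y - x)" by (simp add: mod_eq_dvd_iff)
  then show "x = y" using xy by (simp add: mod_eq_dvd_iff[symmetric])
qed

text \<open>Oddness of \<open>q\<close> enters here: 2 is invertible modulo
  \<open>q\<close>.\<close>

lemma sum_double_mod:
  fixes F :: "int \<Rightarrow> 'a::comm_monoid_add"
  assumes q: "q > 0" "odd q" and F: "periodic q F"
  shows "(\<Sum>x\<in>{0..<q}. F (2 * x)) = (\<Sum>x\<in>{0..<q}. F x)"
proof (rule sum_reindex_mod[OF q(1) F], rule inj_onI)
  fix x y assume xy: "x \<in> {0..<q}" "y \<in> {0..<q}" "(2 * x) mod q = (2 * y) mod q"
  then have "q dvd 2 * (x - y)" by (simp add: mod_eq_dvd_iff algebra_simps)
  moreover have "coprime q 2" using q(2) by simp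
  ultimately have "q dvd x - y"
    by (simp only: coprime_dvd_mult_right_iff)
  then show "x = y" using xy by (simp add: mod_eq_dvd_iff[symmetric])
qed

section \<open>Additive characters modulo \<open>q\<close>\<close>

lemma ee_add: "ee q (x + y) = ee q x * ee q y"
  by (simp add: ee_def cis_mult distrib_left add_divide_distrib)

lemma ee_0 [simp]: "ee q 0 = 1"
  by (simp add: ee_def)

lemma norm_ee [simp]: "norm (ee q x) = 1"
  by (simp add: ee_def)

lemma ee_minus: "ee q (- x) = cnj (ee q x)"
  by (simp add: ee_def cis_cnj)

lemma ee_diff: "ee q (x - y) = ee q x * cnj (ee q y)"
  by (metis ee_add ee_minus diff_conv_add_uminus)

lemma ee_eq_1_iff:
  assumes "q > 0" shows "ee q x = 1 \<longleftrightarrow> q dvd x"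
proof
  assume "ee q x = 1"
  then have "cos (2 * pi * real_of_int x / real_of_int q) = 1"
    by (simp add: ee_def complex_eq_iff)
  then obtain n :: int where "2 * pi * real_of_int x / real_of_int q = real_of_int n * 2 * pi"
    using cos_one_2pi_int by auto
  then have "real_of_int x = real_of_int (n * q)"
    using assms by (simp add: field_simps)
  then have "x = n * q" by linarith
  then show "q dvd x" by simp
next
  assume "q dvd x"
  then obtain k where "x = q * k" by blast
  then show "ee q x = 1"
    using assms by (simp add: ee_def mult_ac cis_multiple_2pi[of "real_of_int k", simplified mult_ac])
qed

lemma periodic_ee: "q > 0 \<Longrightarrow> periodic q (ee q)"
proof (rule periodicI)
  fix x y assume "q > 0" "x mod q = y mod q"
  then have "ee q (x - y) = 1" by (simp add: ee_eq_1_iff mod_eq_dvd_iff)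
  then show "ee q x = ee q y" using ee_add[of q "x - y" y] by simp
qed

lemma periodic_ee_mult: "q > 0 \<Longrightarrow> periodic q (\<lambda>x. ee q (r * x))"
  using periodicD[OF periodic_ee] by (metis (no_types, lifting) mod_mult_right_eq periodicI)

text \<open>Orthogonality of characters: shifting \<open>r\<close> by 1 multiplies the sum by
  \<open>ee q x\<close>, so the sum vanishes unless that factor is 1.\<close>

lemma sum_ee:
  assumes "q > 0"
  shows "(\<Sum>r\<in>{0..<q}. ee q (r * x)) = (if q dvd x then of_int q else 0)"
proof (cases "q dvd x")
  case True
  then have "ee q (r * x) = 1" for r using assms by (simp add: ee_eq_1_iff)
  then show ?thesis using True assms by simp
next
  case False
  have per: "periodic q (\<lambda>r. ee q (r * x))"
    using periodic_ee_mult[OF assms, of x] by (simp add: mult.commute)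
  have "(\<Sum>r\<in>{0..<q}. ee q (r * x)) = (\<Sum>r\<in>{0..<q}. ee q ((r + 1) * x))"
    using sum_shift_mod[OF assms per, of 1] by simp
  also have "\<dots> = (\<Sum>r\<in>{0..<q}. ee q (r * x)) * ee q x"
    by (simp add: distrib_right ee_add sum_distrib_right)
  finally have "(\<Sum>r\<in>{0..<q}. ee q (r * x)) * (ee q x - 1) = 0"
    by (simp add: algebra_simps)
  then show ?thesis using False assms by (simp add: ee_eq_1_iff)
qed

text \<open>The factor \<open>1/q\<close> sits in the transform, so Parseval compares a mean over
  \<open>x\<close> with a plain sum over \<open>r\<close>, and functions with values in [0,1] have
  coefficients of norm at most 1.\<close>

definition ft :: "int \<Rightarrow> (int \<Rightarrow> real) \<Rightarrow> int \<Rightarrow> complex" where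
  "ft q f r = (\<Sum>x\<in>{0..<q}. of_real (f x) * ee q (r * x)) / of_int q"

lemma periodic_ft: "q > 0 \<Longrightarrow> periodic q (ft q f)"
proof (rule periodicI)
  fix r s assume q: "q > 0" and rs: "r mod q = s mod q"
  have "ee q (r * x) = ee q (s * x)" for x
    by (rule periodicD[OF periodic_ee[OF q]]) (metis rs mod_mult_left_eq)
  then show "ft q f r = ft q f s" by (simp add: ft_def)
qed

lemma ft_minus: "ft q f (- r) = cnj (ft q f r)"
  by (simp add: ft_def ee_minus)

lemma norm_ft_minus [simp]: "norm (ft q f (- r)) = norm (ft q f r)"
  by (simp add: ft_minus)

lemma sum_ft_mult_cnj:
  assumes q: "q > 0"
  shows "(\<Sum>r\<in>{0..<q}. ft q f r * cnj (ft q g r)) = of_real ((\<Sum>x\<in>{0..<q}. f x * g x) / of_int q)"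
proof -
  let ?I = "{0..<q}"
  have eq: "ft q f r * cnj (ft q g r) * (of_int q)^2 =
     (\<Sum>x\<in>?I. \<Sum>y\<in>?I. of_real (f x) * of_real (g y) * ee q (r * (x - y)))" for r
  proof -
    have "ft q f r * cnj (ft q g r) * (of_int q)^2 =
      (\<Sum>x\<in>?I. of_real (f x) * ee q (r * x)) * (\<Sum>y\<in>?I. of_real (g y) * cnj (ee q (r * y)))"
      using q by (simp add: ft_def power2_eq_square)
    then show ?thesis
      by (simp add: sum_product right_diff_distrib ee_diff mult_ac)
  qed
  have "(\<Sum>r\<in>?I. ft q f r * cnj (ft q g r)) * (of_int q)^2 =
     (\<Sum>r\<in>?I. (\<Sum>x\<in>?I. \<Sum>y\<in>?I. of_real (f x) * of_real (g y) * ee q (r * (x - y))))"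
    by (simp only: sum_distrib_right eq)
  also have "\<dots> = (\<Sum>x\<in>?I. \<Sum>y\<in>?I. of_real (f x) * of_real (g y) * (\<Sum>r\<in>?I. ee q (r * (x - y))))"
    unfolding sum_distrib_left by (subst sum.swap, rule sum.cong[OF refl], rule sum.swap)
  also have "\<dots> = (\<Sum>x\<in>?I. \<Sum>y\<in>?I. if y = x then of_real (f x) * of_real (g x) * of_int q else 0)"
  proof (intro sum.cong refl)
    fix x y assume "x \<in> ?I" "y \<in> ?I"
    then have "q dvd (x - y) \<longleftrightarrow> y = x"
      by (auto simp: mod_eq_dvd_iff[symmetric])
    then show "of_real (f x) * of_real (g y) * (\<Sum>r\<in>?I. ee q (r * (x - y))) =
      (if y = x then of_real (f x) * of_real (g x) * of_int q else (0::complex))"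
      by (simp add: sum_ee[OF q])
  qed
  also have "\<dots> = (\<Sum>x\<in>?I. of_real (f x) * of_real (g x) * of_int q)"
    by simp
  also have "\<dots> = of_real ((\<Sum>x\<in>?I. f x * g x) / of_int q) * (of_int q)^2"
    using q by (simp add: sum_distrib_right[symmetric] power2_eq_square)
  finally show ?thesis using q by (simp only: mult_cancel_right power_eq_0_iff) auto
qed

lemma parseval:
  assumes q: "q > 0"
  shows "(\<Sum>r\<in>{0..<q}. (norm (ft q f r))^2) = (\<Sum>x\<in>{0..<q}. (f x)^2) / of_int q"
proof -
  have "complex_of_real (\<Sum>r\<in>{0..<q}. (norm (ft q f r))^2) = (\<Sum>r\<in>{0..<q}. ft q f r * cnj (ft q f r))"
    by (simp add: complex_norm_square[symmetric])
  also have "\<dots> = of_real ((\<Sum>x\<in>{0..<q}. f x * f x) / of_int q)"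
    by (rule sum_ft_mult_cnj[OF q])
  finally show ?thesis by (simp add: of_real_eq_iff power2_eq_square del: of_real_sum of_real_divide)
qed

text \<open>Progressions weighted by \<open>f\<close>, listed by common difference \<open>t\<close>
  and middle term \<open>z\<close>; \<open>t = 0\<close> gives the trivial ones. There is no
  normalisation: the indicator of \<open>S\<close> gives \<open>mu q S\<close> times
  \<open>q^2\<close>.\<close>

definition T3 :: "int \<Rightarrow> (int \<Rightarrow> real) \<Rightarrow> real" where
  "T3 q f = (\<Sum>t\<in>{0..<q}. \<Sum>z\<in>{0..<q}. f (z - t) * f z * f (z + t))"

text \<open>Triples subject to a congruence are the shape of \<open>ap3_count\<close>, and the one
  to which orthogonality of characters applies.\<close>

lemma T3_eq_sum:
  assumes q: "q > 0" and f: "periodic q f"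
  shows "T3 q f = (\<Sum>x\<in>{0..<q}. \<Sum>z\<in>{0..<q}. \<Sum>y\<in>{0..<q}. if q dvd (x + y - 2 * z) then f x * f y * f z else 0)"
proof -
  let ?I = "{0..<q}"
  have eq: "(\<Sum>y\<in>?I. if q dvd (x + y - 2 * z) then f x * f y * f z else 0) = f x * f (2 * z - x) * f z" for x z
  proof -
    have "(q dvd (x + y - 2 * z)) = (y = (2 * z - x) mod q)" if "y \<in> ?I" for y
    proof -
      have "y = y mod q" using that by simp
      then have "(y = (2 * z - x) mod q) = (y mod q = (2 * z - x) mod q)" by simp
      also have "\<dots> = (q dvd (x + y - 2 * z))" by (simp add: mod_eq_dvd_iff algebra_simps)
      finally show ?thesis by simp
    qed
    then have "(\<Sum>y\<in>?I. if q dvd (x + y - 2 * z) then f x * f y * f z else 0) =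
      (\<Sum>y\<in>?I. if y = (2 * z - x) mod q then f x * f ((2 * z - x) mod q) * f z else 0)"
      by (intro sum.cong) auto
    also have "\<dots> = f x * f ((2 * z - x) mod q) * f z" using q by simp
    finally show ?thesis using f by (simp add: periodic_def)
  qed
  have "T3 q f = (\<Sum>z\<in>?I. \<Sum>t\<in>?I. f (z - t) * f z * f (2 * z - (z - t)))"
    unfolding T3_def by (subst sum.swap) (simp add: algebra_simps)
  also have "\<dots> = (\<Sum>z\<in>?I. \<Sum>x\<in>?I. f x * f z * f (2 * z - x))"
  proof (rule sum.cong[OF refl])
    fix z
    have "periodic q (\<lambda>x. f x * f z * f (2 * z - x))"
    proof (rule periodicI)
      fix x y assume xy: "x mod q = y mod q"
      then have "(2 * z - x) mod q = (2 * z - y) mod q" by (metis mod_diff_right_eq)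
      with xy show "f x * f z * f (2 * z - x) = f y * f z * f (2 * z - y)"
        using periodicD[OF f] by metis
    qed
    from sum_reflect_mod[OF q this, of z]
    show "(\<Sum>t\<in>?I. f (z - t) * f z * f (2 * z - (z - t))) = (\<Sum>x\<in>?I. f x * f z * f (2 * z - x))" .
  qed
  finally show ?thesis unfolding eq by (subst sum.swap) (simp add: mult_ac)
qed

text \<open>Detecting \<open>q dvd (x + y - 2 * z)\<close> by a sum of characters makes the triple
  sum factor into coefficients at \<open>r\<close>, \<open>r\<close> and
  \<open>- (2 * r)\<close>.\<close>

lemma T3_fourier:
  assumes q: "q > 0" and f: "periodic q f"
  shows "complex_of_real (T3 q f) = (of_int q)^2 * (\<Sum>r\<in>{0..<q}. (ft q f r)^2 * ft q f (- (2 * r)))"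
proof -
  let ?I = "{0..<q}"
  have eq: "(of_int q)^3 * ((ft q f r)^2 * ft q f (- (2 * r))) =
     (\<Sum>x\<in>?I. \<Sum>z\<in>?I. \<Sum>y\<in>?I. of_real (f x * f y * f z) * ee q (r * (x + y - 2 * z)))" for r
  proof -
    have e: "ee q (r * (x + y - 2 * z)) = ee q (r * x) * (ee q (- (2 * r) * z) * ee q (r * y))" for x y z
      unfolding ee_add[symmetric] by (simp add: algebra_simps)
    have "(of_int q)^3 * ((ft q f r)^2 * ft q f (- (2 * r))) =
      (\<Sum>x\<in>?I. of_real (f x) * ee q (r * x)) *
      ((\<Sum>z\<in>?I. of_real (f z) * ee q (- (2 * r) * z)) * (\<Sum>y\<in>?I. of_real (f y) * ee q (r * y)))"
      using q by (simp add: ft_def power2_eq_square power3_eq_cube)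
    also have "\<dots> = (\<Sum>x\<in>?I. \<Sum>z\<in>?I. \<Sum>y\<in>?I. (of_real (f x) * ee q (r * x)) *
        ((of_real (f z) * ee q (- (2 * r) * z)) * (of_real (f y) * ee q (r * y))))"
      by (simp only: sum_product, simp only: sum_distrib_left)
    finally show ?thesis unfolding e by (simp only: of_real_mult mult_ac)
  qed
  have "(of_int q)^3 * (\<Sum>r\<in>?I. (ft q f r)^2 * ft q f (- (2 * r))) =
     (\<Sum>r\<in>?I. \<Sum>x\<in>?I. \<Sum>z\<in>?I. \<Sum>y\<in>?I. of_real (f x * f y * f z) * ee q (r * (x + y - 2 * z)))"
    by (simp only: sum_distrib_left eq)
  also have "\<dots> = (\<Sum>x\<in>?I. \<Sum>z\<in>?I. \<Sum>y\<in>?I. of_real (f x * f y * f z) * (\<Sum>r\<in>?I. ee q (r * (x + y - 2 * z))))"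
    unfolding sum_distrib_left
    by (subst sum.swap, rule sum.cong[OF refl], subst sum.swap, rule sum.cong[OF refl], rule sum.swap)
  also have "\<dots> = (\<Sum>x\<in>?I. \<Sum>z\<in>?I. \<Sum>y\<in>?I. of_real (if q dvd (x + y - 2 * z) then f x * f y * f z else 0) * of_int q)"
    by (intro sum.cong refl) (simp add: sum_ee[OF q])
  also have "\<dots> = of_int q * complex_of_real (T3 q f)"
    unfolding T3_eq_sum[OF q f] by (simp add: sum_distrib_left mult_ac)
  finally show ?thesis using q by (simp add: power2_eq_square power3_eq_cube mult.assoc)
qed

section \<open>Averages over a family of shifts and their Fourier multipliers\<close>

definition avg_shift :: "'j set \<Rightarrow> ('j \<Rightarrow> int) \<Rightarrow> (int \<Rightarrow> real) \<Rightarrow> int \<Rightarrow> real" where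
  "avg_shift J \<tau> f x = (\<Sum>j\<in>J. f (x + \<tau> j)) / real (card J)"

text \<open>Averaging over shifts is a convolution; this is the factor by which it multiplies the
  coefficient at \<open>r\<close>.\<close>

definition mult_ft :: "int \<Rightarrow> 'j set \<Rightarrow> ('j \<Rightarrow> int) \<Rightarrow> int \<Rightarrow> complex" where
  "mult_ft q J \<tau> r = (\<Sum>j\<in>J. ee q (- (r * \<tau> j))) / of_nat (card J)"

lemma periodic_shift: "periodic q f \<Longrightarrow> periodic q (\<lambda>x. f (x + a))"
  by (rule periodicI, rule periodicD, assumption) (metis mod_add_left_eq)

lemma periodic_avg_shift: "periodic q f \<Longrightarrow> periodic q (avg_shift J \<tau> f)"
proof (rule periodicI)
  fix x y assume f: "periodic q f" and xy: "x mod q = y mod q"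
  have "f (x + a) = f (y + a)" for a
    by (rule periodicD[OF periodic_shift[OF f] xy])
  then show "avg_shift J \<tau> f x = avg_shift J \<tau> f y" by (simp add: avg_shift_def)
qed

lemma ft_shift:
  assumes q: "q > 0" and f: "periodic q f"
  shows "ft q (\<lambda>x. f (x + a)) r = ft q f r * ee q (- (r * a))"
proof -
  have per: "periodic q (\<lambda>x. of_real (f x) * ee q (r * (x - a)))"
  proof (rule periodicI)
    fix x y assume xy: "x mod q = y mod q"
    then have "r * (x - a) mod q = r * (y - a) mod q" by (metis mod_diff_left_eq mod_mult_right_eq)
    then show "of_real (f x) * ee q (r * (x - a)) = of_real (f y) * ee q (r * (y - a))"
      using periodicD[OF f xy] periodicD[OF periodic_ee[OF q]] by metis
  qed
  have "(\<Sum>x\<in>{0..<q}. of_real (f (x + a)) * ee q (r * x)) = (\<Sum>x\<in>{0..<q}. of_real (f x) * ee q (r * (x - a)))"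
    using sum_shift_mod[OF q per, of a] by simp
  also have "\<dots> = (\<Sum>x\<in>{0..<q}. of_real (f x) * ee q (r * x)) * ee q (- (r * a))"
    by (simp add: sum_distrib_right right_diff_distrib ee_diff ee_minus mult.assoc)
  finally show ?thesis by (simp add: ft_def)
qed

lemma ft_avg_shift:
  assumes q: "q > 0" and f: "periodic q f"
  shows "ft q (avg_shift J \<tau> f) r = ft q f r * mult_ft q J \<tau> r"
proof -
  have "ft q (avg_shift J \<tau> f) r = (\<Sum>j\<in>J. ft q (\<lambda>x. f (x + \<tau> j)) r) / of_nat (card J)"
  proof -
    have "(\<Sum>x\<in>{0..<q}. of_real (avg_shift J \<tau> f x) * ee q (r * x)) =
      (\<Sum>x\<in>{0..<q}. \<Sum>j\<in>J. of_real (f (x + \<tau> j)) * ee q (r * x)) / of_nat (card J)"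
      by (simp add: avg_shift_def sum_distrib_right sum_divide_distrib)
    also have "\<dots> = (\<Sum>j\<in>J. \<Sum>x\<in>{0..<q}. of_real (f (x + \<tau> j)) * ee q (r * x)) / of_nat (card J)"
      by (subst sum.swap) simp
    finally show ?thesis by (simp add: ft_def sum_divide_distrib mult.commute)
  qed
  then show ?thesis
    by (simp add: ft_shift[OF q f] mult_ft_def sum_distrib_left)
qed

lemma norm_mult_ft_le: "norm (mult_ft q J \<tau> r) \<le> 1"
proof -
  have "norm (\<Sum>j\<in>J. ee q (- (r * \<tau> j))) \<le> real (card J)"
    by (rule order_trans[OF norm_sum]) simp
  then show ?thesis by (cases "card J = 0") (simp_all add: mult_ft_def norm_divide)
qed

lemma norm_ee_minus_1_uminus: "norm (ee q (- x) - 1) = norm (ee q x - 1)"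
  by (metis complex_cnj_diff complex_cnj_one complex_mod_cnj ee_minus)

lemma norm_ee_add_le: "norm (ee q (x + y) - 1) \<le> norm (ee q x - 1) + norm (ee q y - 1)"
proof -
  have "ee q (x + y) - 1 = ee q x * (ee q y - 1) + (ee q x - 1)"
    by (simp add: ee_add algebra_simps)
  then have "norm (ee q (x + y) - 1) \<le> norm (ee q x * (ee q y - 1)) + norm (ee q x - 1)"
    by (metis norm_triangle_ineq)
  then show ?thesis by (simp add: norm_mult)
qed

lemma norm_ee_mult_le: "norm (ee q (int n * x) - 1) \<le> real n * norm (ee q x - 1)"
proof (induction n)
  case (Suc n)
  then show ?case using norm_ee_add_le[of q "int n * x" x] by (simp add: algebra_simps)
qed simp

lemma norm_mult_ft_minus_1_le:
  assumes J: "finite J" "J \<noteq> {}" and b: "\<And>j. j \<in> J \<Longrightarrow> norm (ee q (r * \<tau> j) - 1) \<le> \<delta>"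
  shows "norm (mult_ft q J \<tau> r - 1) \<le> \<delta>"
proof -
  have c: "card J > 0" using J by (simp add: card_gt_0_iff)
  have "of_nat (card J) * (mult_ft q J \<tau> r - 1) = (\<Sum>j\<in>J. ee q (- (r * \<tau> j)) - 1)"
    using c J by (simp add: mult_ft_def sum_subtractf right_diff_distrib)
  moreover have "norm (\<Sum>j\<in>J. ee q (- (r * \<tau> j)) - 1) \<le> real (card J) * \<delta>"
    by (rule sum_norm_bound) (simp add: norm_ee_minus_1_uminus b)
  ultimately have "real (card J) * norm (mult_ft q J \<tau> r - 1) \<le> real (card J) * \<delta>"
    by (metis norm_mult norm_of_nat)
  then show ?thesis using c by simp
qed

lemma ee_double_le: "norm (ee q (2 * r * x) - 1) \<le> 2 * norm (ee q (r * x) - 1)"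
  using norm_ee_mult_le[of q 2 "r * x"] by (simp add: mult_ac)

lemma sum_norm_ft_le_1:
  assumes q: "q > 0" and f01: "\<And>x. 0 \<le> f x \<and> f x \<le> 1"
  shows "(\<Sum>r\<in>{0..<q}. (norm (ft q f r))^2) \<le> 1"
proof -
  have "(\<Sum>x\<in>{0..<q}. (f x)^2) \<le> of_nat (card {0..<q}) * 1"
    by (rule sum_bounded_above) (simp add: f01 power_le_one)
  then show ?thesis using q by (simp add: parseval)
qed

text \<open>Each term of \<open>T3_fourier\<close> changes by at most \<open>2 * \<eta>\<close>
  times the squared norm of the coefficient at \<open>r\<close>. If the coefficient at
  \<open>2 * r\<close> is below \<open>\<eta>\<close>, it supplies the factor itself; otherwise all
  multipliers are close to 1. Parseval then sums the squares to at most 1.\<close>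

lemma smoothing:
  assumes q: "q > 0" and f: "periodic q f" and f01: "\<And>x. 0 \<le> f x \<and> f x \<le> 1"
    and J: "finite J" "J \<noteq> {}" and \<eta>: "0 \<le> \<eta>"
    and close: "\<And>r j. r \<in> {0..<q} \<Longrightarrow> norm (ft q f (2 * r)) \<ge> \<eta> \<Longrightarrow> j \<in> J \<Longrightarrow> norm (ee q (r * \<tau> j) - 1) \<le> \<eta> / 4"
  shows "\<bar>T3 q (avg_shift J \<tau> f) - T3 q f\<bar> \<le> 2 * \<eta> * of_int q ^ 2"
proof -
  let ?I = "{0..<q}" and ?g = "avg_shift J \<tau> f" and ?b = "mult_ft q J \<tau>"
  have bd: "norm ((ft q ?g r)^2 * ft q ?g (- (2 * r)) - (ft q f r)^2 * ft q f (- (2 * r)))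
     \<le> 2 * \<eta> * (norm (ft q f r))^2" if r: "r \<in> ?I" for r
  proof -
    let ?B = "(?b r)^2 * ?b (- (2 * r))"
    have "(ft q ?g r)^2 * ft q ?g (- (2 * r)) - (ft q f r)^2 * ft q f (- (2 * r))
       = (ft q f r)^2 * (ft q f (- (2 * r)) * (?B - 1))"
      by (simp add: ft_avg_shift[OF q f] power_mult_distrib algebra_simps)
    moreover have "norm (ft q f (- (2 * r)) * (?B - 1)) \<le> 2 * \<eta>"
    proof (cases "norm (ft q f (2 * r)) \<ge> \<eta>")
      case False
      have "norm ?B \<le> 1"
        by (simp add: norm_mult norm_power mult_le_one norm_mult_ft_le power_le_one)
      then have "norm (?B - 1) \<le> 2"
        using norm_triangle_ineq4[of ?B 1] by simp
      then show ?thesis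
        using False mult_mono[of "norm (ft q f (2 * r))" \<eta> "norm (?B - 1)" 2] \<eta> by (simp add: norm_mult mult_ac)
    next
      case True
      have b1: "norm (?b r - 1) \<le> \<eta> / 4"
        by (rule norm_mult_ft_minus_1_le[OF J]) (use close[OF r True] in auto)
      have b2: "norm (?b (- (2 * r)) - 1) \<le> \<eta> / 2"
      proof (rule norm_mult_ft_minus_1_le[OF J])
        fix j assume "j \<in> J"
        from close[OF r True this] ee_double_le[of q r "\<tau> j"]
        have "norm (ee q (2 * r * \<tau> j) - 1) \<le> \<eta> / 2" by simp
        then show "norm (ee q (- (2 * r) * \<tau> j) - 1) \<le> \<eta> / 2"
          by (metis norm_ee_minus_1_uminus mult_minus_left)
      qed
      \<comment> \<open>Telescoping the product of three multipliers leaves errors of at most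
        \<open>\<eta> / 2\<close>, \<open>\<eta> / 4\<close> and \<open>\<eta> / 4\<close>.\<close>
      have eq: "?B - 1 = ?b r * ?b r * (?b (- (2 * r)) - 1) + ?b r * (?b r - 1) + (?b r - 1)"
        by (simp add: power2_eq_square algebra_simps)
      have "norm (?B - 1) \<le> norm (?b r * ?b r * (?b (- (2 * r)) - 1)) + norm (?b r * (?b r - 1)) + norm (?b r - 1)"
        unfolding eq using norm_triangle_ineq[of "?b r * ?b r * (?b (- (2 * r)) - 1) + ?b r * (?b r - 1)" "?b r - 1"]
          norm_triangle_ineq[of "?b r * ?b r * (?b (- (2 * r)) - 1)" "?b r * (?b r - 1)"] by linarith
      also have "\<dots> \<le> norm (?b (- (2 * r)) - 1) + norm (?b r - 1) + norm (?b r - 1)"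
        by (intro add_mono order_refl) (simp_all add: norm_mult mult_left_le_one_le mult_le_one norm_mult_ft_le)
      also have "\<dots> \<le> 2 * \<eta>" using b1 b2 \<eta> by linarith
      finally have B: "norm (?B - 1) \<le> 2 * \<eta>" .
      have "norm (ft q f (2 * r)) \<le> 1"
      proof -
        have "norm (\<Sum>x\<in>?I. of_real (f x) * ee q (2 * r * x)) \<le> of_nat (card ?I) * 1"
          by (rule sum_norm_bound) (simp add: norm_mult f01)
        then show ?thesis using q by (simp add: ft_def norm_divide)
      qed
      then show ?thesis using B by (simp add: norm_mult mult_left_le_one_le order_trans[OF mult_left_le_one_le])
    qed
    ultimately show ?thesis
      by (metis norm_mult norm_power mult.commute mult_left_mono zero_le_power2)
  qed
  have "norm (complex_of_real (T3 q ?g) - complex_of_real (T3 q f)) =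
     of_int q ^ 2 * norm (\<Sum>r\<in>?I. (ft q ?g r)^2 * ft q ?g (- (2 * r)) - (ft q f r)^2 * ft q f (- (2 * r)))"
    by (simp add: T3_fourier[OF q f] T3_fourier[OF q periodic_avg_shift[OF f]] sum_subtractf
        right_diff_distrib[symmetric] norm_mult norm_power)
  also have "\<dots> \<le> of_int q ^ 2 * (\<Sum>r\<in>?I. 2 * \<eta> * (norm (ft q f r))^2)"
    by (intro mult_left_mono order_trans[OF norm_sum] sum_mono bd) auto
  also have "\<dots> = of_int q ^ 2 * (2 * \<eta> * (\<Sum>r\<in>?I. (norm (ft q f r))^2))"
    by (simp add: sum_distrib_left)
  also have "\<dots> \<le> of_int q ^ 2 * (2 * \<eta> * 1)"
    using sum_norm_ft_le_1[OF q f01] \<eta> by (intro mult_left_mono) auto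
  finally show ?thesis by (simp add: mult_ac flip: of_real_diff)
qed

section \<open>Bohr sets\<close>

text \<open>The radius \<open>2 * pi / N\<close> is the length of one of \<open>N\<close> equal arcs
  of the unit circle, which suits a pigeonhole argument on arcs.\<close>

definition bohr :: "int \<Rightarrow> int set \<Rightarrow> nat \<Rightarrow> int set" where
  "bohr q R N = {x \<in> {0..<q}. \<forall>r\<in>R. norm (ee q (r * x) - 1) \<le> 2 * pi / real N}"

lemma finite_bohr [simp]: "finite (bohr q R N)"
  by (rule finite_subset[of _ "{0..<q}"]) (auto simp: bohr_def)

lemma zero_in_bohr: "q > 0 \<Longrightarrow> 0 \<in> bohr q R N"
  by (simp add: bohr_def)

lemma norm_cis_minus_1_le: "norm (cis t - 1) \<le> \<bar>t\<bar>"
proof -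
  have "norm (cis t - 1) = 2 * \<bar>sin (t / 2)\<bar>"
    using dist_exp_i_1[of t] by (simp add: cis_conv_exp)
  also have "\<dots> \<le> 2 * \<bar>t / 2\<bar>" using abs_sin_x_le_abs_x[of "t / 2"] by simp
  finally show ?thesis by simp
qed

text \<open>Pigeonhole: sort the \<open>x\<close> by the cells \<open>\<lfloor>N {r x / q}\<rfloor>\<close>, \<open>r \<in> R\<close>; differences
  within one cell lie in the Bohr set.\<close>
lemma card_bohr_ge:
  assumes q: "q > 0" and R: "finite R" and N: "N > 0"
  shows "real_of_int q \<le> real (card (bohr q R N)) * real N ^ card R"
proof -
  define c where "c x = (\<lambda>r\<in>R. N * nat ((r * x) mod q) div nat q)" for x
  have c: "c \<in> {0..<q} \<rightarrow> PiE R (\<lambda>_. {..<N})"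
  proof
    fix x assume "x \<in> {0..<q}"
    have "N * nat ((r * x) mod q) div nat q < N" for r
    proof (rule less_mult_imp_div_less)
      have "nat ((r * x) mod q) < nat q" using q by simp
      then show "N * nat ((r * x) mod q) < N * nat q" using N by simp
    qed
    then show "c x \<in> PiE R (\<lambda>_. {..<N})" by (auto simp: c_def)
  qed
  have fin: "finite (PiE R (\<lambda>_. {..<N}))" using R by (simp add: finite_PiE)
  have fibre: "card {x \<in> {0..<q}. c x = v} \<le> card (bohr q R N)" for v
  proof (cases "{x \<in> {0..<q}. c x = v} = {}")
    case False
    then obtain x0 where x0: "x0 \<in> {0..<q}" "c x0 = v" by blast
    \<comment> \<open>Subtracting a fixed member \<open>x0\<close> embeds the whole cell injectively
      into the Bohr set.\<close>
    have "(\<lambda>x. (x - x0) mod q) ` {x \<in> {0..<q}. c x = v} \<subseteq> bohr q R N"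
    proof
      fix y assume "y \<in> (\<lambda>x. (x - x0) mod q) ` {x \<in> {0..<q}. c x = v}"
      then obtain x where x: "x \<in> {0..<q}" "c x = c x0" and y: "y = (x - x0) mod q" using x0 by auto
      have "norm (ee q (r * y) - 1) \<le> 2 * pi / real N" if r: "r \<in> R" for r
      proof -
        define a b where "a = (r * x) mod q" and "b = (r * x0) mod q"
        have ab: "0 \<le> a" "0 \<le> b" using q by (simp_all add: a_def b_def)
        have eq: "N * nat a div nat q = N * nat b div nat q"
          using fun_cong[OF x(2), of r] r by (simp add: c_def a_def b_def)
        let ?k = "N * nat a div nat q"
        have "?k * nat q \<le> N * nat a" "N * nat a < (?k + 1) * nat q"
          "?k * nat q \<le> N * nat b" "N * nat b < (?k + 1) * nat q"
          using q dividend_less_div_times[of "nat q" "N * nat a"] dividend_less_div_times[of "nat q" "N * nat b"]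
            div_times_less_eq_dividend[of "N * nat a" "nat q"] div_times_less_eq_dividend[of "N * nat b" "nat q"]
          unfolding eq by (simp_all add: algebra_simps)
        then have "real (?k * nat q) \<le> real (N * nat a)" "real (N * nat a) \<le> real ((?k + 1) * nat q)"
          "real (?k * nat q) \<le> real (N * nat b)" "real (N * nat b) \<le> real ((?k + 1) * nat q)"
          by (simp_all only: of_nat_le_iff less_imp_le)
        then have "\<bar>real N * real_of_int (a - b)\<bar> \<le> real_of_int q"
          using ab q by (simp add: algebra_simps abs_le_iff)
        then have *: "\<bar>2 * pi * real_of_int (a - b) / real_of_int q\<bar> \<le> 2 * pi / real N"
        proof -
          have "\<bar>real_of_int (a - b)\<bar> * real N \<le> real_of_int q"
            using \<open>\<bar>real N * real_of_int (a - b)\<bar> \<le> real_of_int q\<close> by (simp add: abs_mult mult.commute)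
          then have "2 * pi * (\<bar>real_of_int (a - b)\<bar> * real N) \<le> 2 * pi * real_of_int q"
            by (intro mult_left_mono) auto
          then show ?thesis using N q by (simp add: abs_mult field_simps del: of_int_diff)
        qed
        have "(r * y) mod q = (a - b) mod q"
          unfolding y a_def b_def by (simp add: mod_mult_right_eq mod_diff_eq right_diff_distrib)
        then have "ee q (r * y) = ee q (a - b)"
          by (rule periodicD[OF periodic_ee[OF q]])
        moreover have "norm (ee q (a - b) - 1) \<le> 2 * pi / real N"
          unfolding ee_def by (rule order_trans[OF norm_cis_minus_1_le *])
        ultimately show ?thesis by (simp only:)
      qed
      then show "y \<in> bohr q R N" using q y by (simp add: bohr_def)
    qed
    moreover have "inj_on (\<lambda>x. (x - x0) mod q) {x \<in> {0..<q}. c x = v}"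
    proof (rule inj_onI)
      fix x y assume xy: "x \<in> {x \<in> {0..<q}. c x = v}" "y \<in> {x \<in> {0..<q}. c x = v}"
        "(x - x0) mod q = (y - x0) mod q"
      then have "q dvd (x - y)" by (simp add: mod_eq_dvd_iff)
      then show "x = y" using xy by (simp add: mod_eq_dvd_iff[symmetric])
    qed
    ultimately show ?thesis using card_inj_on_le finite_bohr by blast
  next
    case True
    show ?thesis unfolding True by simp
  qed
  have "{0..<q} = (\<Union>v\<in>PiE R (\<lambda>_. {..<N}). {x \<in> {0..<q}. c x = v})"
    using c by auto
  then have "card {0..<q} \<le> (\<Sum>v\<in>PiE R (\<lambda>_. {..<N}). card {x \<in> {0..<q}. c x = v})"
    using card_UN_le[OF fin, of "\<lambda>v. {x \<in> {0..<q}. c x = v}"] by argo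
  also have "\<dots> \<le> card (PiE R (\<lambda>_. {..<N})) * card (bohr q R N)"
    using sum_bounded_above[of "PiE R (\<lambda>_. {..<N})" "\<lambda>v. card {x \<in> {0..<q}. c x = v}"] fibre by simp
  also have "\<dots> = N ^ card R * card (bohr q R N)"
    using R by (simp add: card_PiE)
  finally have "nat q \<le> card (bohr q R N) * N ^ card R" by (simp add: mult.commute)
  then have "real (nat q) \<le> real (card (bohr q R N) * N ^ card R)" by (simp only: of_nat_le_iff)
  then show ?thesis using q by simp
qed

text \<open>The large spectrum, indexed by \<open>r\<close> but tested at \<open>2 * r\<close>,
  since \<open>smoothing\<close> splits the frequencies by that coefficient. For odd
  \<open>q\<close> doubling permutes the residues, so Parseval still controls the size.\<close>

definition spec :: "int \<Rightarrow> (int \<Rightarrow> real) \<Rightarrow> real \<Rightarrow> int set" where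
  "spec q f \<eta> = {r \<in> {0..<q}. norm (ft q f (2 * r)) \<ge> \<eta>}"

lemma finite_spec [simp]: "finite (spec q f \<eta>)"
  by (rule finite_subset[of _ "{0..<q}"]) (auto simp: spec_def)

lemma sum_norm_ft_double:
  assumes q: "q > 0" "odd q"
  shows "(\<Sum>r\<in>{0..<q}. h (ft q f (2 * r))) = (\<Sum>r\<in>{0..<q}. h (ft q f r))"
  by (rule sum_double_mod[OF q, of "\<lambda>r. h (ft q f r)"])
     (use periodic_ft[OF q(1), of f] in \<open>simp add: periodic_def\<close>)

text \<open>Chebyshev's inequality applied to Parseval's identity.\<close>

lemma card_spec_le:
  assumes q: "q > 0" "odd q" and f01: "\<And>x. 0 \<le> f x \<and> f x \<le> 1" and \<eta>: "\<eta> > 0"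
  shows "real (card (spec q f \<eta>)) \<le> 1 / \<eta>^2"
proof -
  have "real (card (spec q f \<eta>)) * \<eta>^2 \<le> (\<Sum>r\<in>spec q f \<eta>. (norm (ft q f (2 * r)))^2)"
    by (rule sum_bounded_below) (use \<eta> in \<open>auto simp: spec_def intro: power_mono\<close>)
  also have "\<dots> \<le> (\<Sum>r\<in>{0..<q}. (norm (ft q f (2 * r)))^2)"
    by (rule sum_mono2) (auto simp: spec_def)
  also have "\<dots> \<le> 1"
    using sum_norm_ft_le_1[OF q(1) f01] sum_norm_ft_double[OF q, of "\<lambda>z. (norm z)^2"] by simp
  finally show ?thesis using \<eta> by (simp add: field_simps)
qed

text \<open>The number of arcs, not the radius itself. As 26 exceeds \<open>8 * pi\<close>, the
  radius \<open>2 * pi / N\<close> is at most \<open>\<eta> / 4\<close>, as \<open>smoothing\<close>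
  requires.\<close>

definition bohr_radius :: "real \<Rightarrow> nat" where
  "bohr_radius \<eta> = nat \<lceil>26 / \<eta>\<rceil>"

lemma bohr_radius_bound:
  assumes "\<eta> > 0"
  shows "bohr_radius \<eta> > 0" and "2 * pi / real (bohr_radius \<eta>) \<le> \<eta> / 4"
proof -
  have n: "real (bohr_radius \<eta>) \<ge> 26 / \<eta>" unfolding bohr_radius_def by (rule real_nat_ceiling_ge)
  moreover have p: "26 / \<eta> > 0" using assms by simp
  ultimately have "real (bohr_radius \<eta>) > 0" by linarith
  then show "bohr_radius \<eta> > 0" by simp
  have "8 * pi \<le> 26" using pi_approx by simp
  also have "26 \<le> real (bohr_radius \<eta>) * \<eta>" using n assms by (simp add: field_simps)
  finally show "2 * pi / real (bohr_radius \<eta>) \<le> \<eta> / 4"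
    using \<open>real (bohr_radius \<eta>) > 0\<close> by (simp add: field_simps)
qed

text \<open>Lower bound for the density of the Bohr set of a spectrum with at most
  \<open>1 / \<eta>^2\<close> frequencies. It depends on \<open>\<eta>\<close> alone, which keeps
  the final bound independent of \<open>q\<close>.\<close>

definition bohr_density :: "real \<Rightarrow> real" where
  "bohr_density \<eta> = 1 / real (bohr_radius \<eta>) ^ nat \<lceil>1 / \<eta>^2\<rceil>"

lemma bohr_density_pos: "\<eta> > 0 \<Longrightarrow> bohr_density \<eta> > 0"
  by (simp add: bohr_density_def bohr_radius_bound)

lemma bohr_density_le_1: "\<eta> > 0 \<Longrightarrow> bohr_density \<eta> \<le> 1"
  using bohr_radius_bound(1)[of \<eta>] by (simp add: bohr_density_def)

lemma card_spec_bohr_ge: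
  assumes q: "q > 0" "odd q" and f01: "\<And>x. 0 \<le> f x \<and> f x \<le> 1" and \<eta>: "\<eta> > 0"
  shows "bohr_density \<eta> * real_of_int q \<le> real (card (bohr q (spec q f \<eta>) (bohr_radius \<eta>)))"
proof -
  let ?N = "bohr_radius \<eta>" and ?R = "spec q f \<eta>"
  have N: "?N > 0" using bohr_radius_bound[OF \<eta>] by simp
  have "card ?R \<le> nat \<lceil>1 / \<eta>^2\<rceil>"
    using card_spec_le[where f = f, OF q f01 \<eta>] real_nat_ceiling_ge[of "1 / \<eta>^2"] by linarith
  then have "real ?N ^ card ?R \<le> real ?N ^ nat \<lceil>1 / \<eta>^2\<rceil>"
    using N by (intro power_increasing) auto
  then have "real_of_int q \<le> real (card (bohr q ?R ?N)) * real ?N ^ nat \<lceil>1 / \<eta>^2\<rceil>"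
    using card_bohr_ge[OF q(1) finite_spec[of q f \<eta>] N] by (meson mult_left_mono of_nat_0_le_iff order_trans)
  then show ?thesis using N by (simp add: bohr_density_def field_simps)
qed

section \<open>Varnavides' theorem modulo an odd number\<close>

text \<open>Up to conjugation and the factor \<open>q / card B\<close>, the multiplier is the
  transform of the indicator of \<open>B\<close>, so Parseval applies.\<close>

lemma sum_norm_mult_ft:
  assumes q: "q > 0" and B: "B \<subseteq> {0..<q}" "B \<noteq> {}"
  shows "(\<Sum>r\<in>{0..<q}. (norm (mult_ft q B (\<lambda>j. j) r))^2) = real_of_int q / real (card B)"
proof -
  define u where "u x = (if x \<in> B then 1 else 0 :: real)" for x
  have fin: "finite B" using B(1) finite_subset by blast
  then have c: "card B > 0" using B by (simp add: card_gt_0_iff)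
  have "mult_ft q B (\<lambda>j. j) r = cnj (ft q u r) * of_int q / of_nat (card B)" for r
  proof -
    have "(\<Sum>x\<in>{0..<q}. of_real (u x) * ee q (r * x)) = (\<Sum>x\<in>{0..<q}. if x \<in> B then ee q (r * x) else 0)"
      by (rule sum.cong) (auto simp: u_def)
    also have "\<dots> = (\<Sum>x\<in>B. ee q (r * x))"
      using B by (simp add: sum.inter_restrict[symmetric] Int_absorb1)
    finally show ?thesis using q by (simp add: mult_ft_def ft_def ee_minus)
  qed
  then have "(norm (mult_ft q B (\<lambda>j. j) r))^2 = (norm (ft q u r))^2 * (of_int q / of_nat (card B))^2" for r
    by (simp add: norm_mult norm_divide power_mult_distrib power_divide)
  then have "(\<Sum>r\<in>{0..<q}. (norm (mult_ft q B (\<lambda>j. j) r))^2) =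
    (\<Sum>r\<in>{0..<q}. (norm (ft q u r))^2) * (of_int q / of_nat (card B))^2"
    by (simp add: sum_distrib_right)
  also have "(\<Sum>r\<in>{0..<q}. (norm (ft q u r))^2) = (\<Sum>x\<in>{0..<q}. if x \<in> B then 1 else 0) / of_int q"
    by (simp add: parseval[OF q]) (rule disjI2, rule sum.cong, auto simp: u_def)
  also have "(\<Sum>x\<in>{0..<q}. if x \<in> B then 1 else 0) = real (card B)"
    using B by (simp add: sum.inter_restrict[symmetric] Int_absorb1)
  finally show ?thesis using q c by (simp add: power2_eq_square field_simps)
qed

lemma avg_shift_bounds:
  assumes "\<And>x. 0 \<le> f x \<and> f x \<le> 1"
  shows "0 \<le> avg_shift J \<tau> f x \<and> avg_shift J \<tau> f x \<le> 1"
proof -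
  have "(\<Sum>j\<in>J. f (x + \<tau> j)) \<le> of_nat (card J) * 1"
    by (rule sum_bounded_above) (simp add: assms)
  then show ?thesis
    by (cases "card J = 0") (simp_all add: avg_shift_def assms sum_nonneg)
qed

lemma sum_avg_shift:
  assumes q: "q > 0" and f: "periodic q f" and J: "finite J" "J \<noteq> {}"
  shows "(\<Sum>x\<in>{0..<q}. avg_shift J \<tau> f x) = (\<Sum>x\<in>{0..<q}. f x)"
proof -
  have "(\<Sum>x\<in>{0..<q}. avg_shift J \<tau> f x) = (\<Sum>j\<in>J. \<Sum>x\<in>{0..<q}. f (x + \<tau> j)) / real (card J)"
    unfolding avg_shift_def sum_divide_distrib[symmetric] by (subst sum.swap) simp
  then show ?thesis using J by (simp add: sum_shift_mod[OF q f] card_gt_0_iff)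
qed

text \<open>Three scales: \<open>\<alpha>\<close> governs the common differences, \<open>\<beta>\<close> the Bohr set over which \<open>f\<close> is averaged, and
  coefficients below \<open>\<gamma>\<close> are negligible after averaging. When \<open>f\<close> has little energy between \<open>\<gamma>\<close> and
  \<open>\<alpha>\<close>, the average is almost invariant under the common differences.\<close>
locale roth_setting =
  fixes q :: int and f :: "int \<Rightarrow> real" and \<rho> \<alpha> \<beta> \<gamma> :: real
  assumes q: "q > 0" "odd q" and f: "periodic q f" and f01: "\<And>x. 0 \<le> f x \<and> f x \<le> 1"
    and \<rho>: "0 < \<rho>" "\<rho> \<le> 1" and density: "\<rho> * of_int q \<le> (\<Sum>x\<in>{0..<q}. f x)"
    and \<alpha>: "0 < \<alpha>" "\<alpha> \<le> \<rho>^3 / 8" and \<beta>: "0 < \<beta>" "\<beta> \<le> bohr_density \<alpha> * \<rho>^3 / 16"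
    and \<gamma>: "0 < \<gamma>" "\<gamma> \<le> bohr_density \<beta> * \<rho>^3 / 16"
    and energy: "(\<Sum>r\<in>spec q f \<gamma> - spec q f \<alpha>. (norm (ft q f (2 * r)))^2) \<le> \<rho>^6 / 128"
begin

definition B where "B = bohr q (spec q f \<beta>) (bohr_radius \<beta>)"
definition g where "g = avg_shift B (\<lambda>j. j) f"

lemma B: "B \<subseteq> {0..<q}" "B \<noteq> {}" "finite B"
proof -
  show "finite B" unfolding B_def by (rule finite_bohr)
  show "B \<noteq> {}" using zero_in_bohr[OF q(1)] unfolding B_def by blast
  show "B \<subseteq> {0..<q}" by (auto simp: B_def bohr_def)
qed

lemma card_B: "bohr_density \<beta> * of_int q \<le> real (card B)"
  unfolding B_def by (rule card_spec_bohr_ge[OF q f01 \<beta>(1)])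

lemma g: "periodic q g"
  unfolding g_def by (rule periodic_avg_shift[OF f])

lemma g01: "0 \<le> g x" "g x \<le> 1"
  using avg_shift_bounds[of f, OF f01] by (auto simp: g_def)

text \<open>By Parseval the difference is a sum over frequencies, split into three ranges: on the
  spectrum at \<open>\<alpha>\<close> the phase of \<open>t\<close> is nearly 1, between
  \<open>\<gamma>\<close> and \<open>\<alpha>\<close> there is little energy, and below
  \<open>\<gamma>\<close> the mean square of the multiplier of \<open>B\<close> is small
  enough.\<close>

lemma shift_g_L2:
  assumes t: "t \<in> bohr q (spec q f \<alpha>) (bohr_radius \<alpha>)"
  shows "(\<Sum>z\<in>{0..<q}. (g (z + t) - g z)^2) \<le> \<rho>^6 / 16 * of_int q"
proof -
  let ?I = "{0..<q}"
  let ?F = "\<lambda>r. (norm (ft q f (2 * r)))^2" and ?b = "mult_ft q B (\<lambda>j. j)"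
  have ft_h: "ft q (\<lambda>z. g (z + t) - g z) r = ft q f r * ?b r * (ee q (- (r * t)) - 1)" for r
  proof -
    have "ft q (\<lambda>z. g (z + t) - g z) r = ft q (\<lambda>z. g (z + t)) r - ft q g r"
      by (simp add: ft_def left_diff_distrib sum_subtractf diff_divide_distrib)
    then show ?thesis
      unfolding ft_shift[OF q(1) g] unfolding g_def ft_avg_shift[OF q(1) f] by (simp add: algebra_simps)
  qed
  \<comment> \<open>One summand on the right for each of the three ranges. They will contribute
    \<open>\<rho>^6\<close> times 1/256, 1/32 and 1/64, in total less than 1/16.\<close>
  have bound: "(norm (ft q (\<lambda>z. g (z + t) - g z) (2 * r)))^2 \<le>
     \<rho>^6 / 256 * ?F r + (if r \<in> spec q f \<gamma> - spec q f \<alpha> then 4 * ?F r else 0) + 4 * \<gamma>^2 * (norm (?b (2 * r)))^2"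
    if r: "r \<in> ?I" for r
  proof -
    define e where "e = norm (ee q (2 * r * t) - 1)"
    have e2: "e \<le> 2" using norm_triangle_ineq4[of "ee q (2 * r * t)" 1] by (simp add: e_def)
    have e0: "e \<ge> 0" by (simp add: e_def)
    have esq: "e^2 \<le> 4" using power_mono[OF e2 e0, of 2] by simp
    have b1: "(norm (?b (2 * r)))^2 \<le> 1" by (intro power_le_one norm_mult_ft_le) simp
    have eq: "(norm (ft q (\<lambda>z. g (z + t) - g z) (2 * r)))^2 = ?F r * (norm (?b (2 * r)))^2 * e^2"
      unfolding ft_h e_def norm_ee_minus_1_uminus[of q "2 * r * t", symmetric] by (simp add: norm_mult power_mult_distrib)
    have F0: "?F r \<ge> 0" and b0: "(norm (?b (2 * r)))^2 \<ge> 0" by simp_all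
    consider (1) "r \<in> spec q f \<alpha>" | (2) "r \<in> spec q f \<gamma> - spec q f \<alpha>" | (3) "r \<notin> spec q f \<gamma>" "r \<notin> spec q f \<alpha>" by blast
    then show ?thesis
    proof cases
      case 1
      have "norm (ee q (r * t) - 1) \<le> \<alpha> / 4"
        using t 1 bohr_radius_bound(2)[OF \<alpha>(1)] by (force simp: bohr_def)
      then have "e \<le> \<rho>^3 / 16" using ee_double_le[of q r t] \<alpha> by (simp add: e_def)
      then have "e^2 \<le> (\<rho>^3 / 16)^2" using e0 by (intro power_mono)
      also have "\<dots> = \<rho>^6 / 256" by (simp add: power_divide flip: power_mult)
      finally have "?F r * (norm (?b (2 * r)))^2 * e^2 \<le> ?F r * 1 * (\<rho>^6 / 256)"
        using b1 by (intro mult_mono) auto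
      moreover have "0 \<le> 4 * \<gamma>^2 * (norm (?b (2 * r)))^2" by simp
      moreover have "?F r * 1 * (\<rho>^6 / 256) = \<rho>^6 / 256 * ?F r" by simp
      moreover have i: "(if r \<in> spec q f \<gamma> - spec q f \<alpha> then 4 * ?F r else 0) = 0" using 1 by simp
      ultimately show ?thesis unfolding eq i by linarith
    next
      case 2
      have "?F r * (norm (?b (2 * r)))^2 * e^2 \<le> ?F r * 1 * 4"
        using b1 esq by (intro mult_mono) auto
      moreover have "0 \<le> \<rho>^6 / 256 * ?F r" "0 \<le> 4 * \<gamma>^2 * (norm (?b (2 * r)))^2" by simp_all
      moreover have i: "(if r \<in> spec q f \<gamma> - spec q f \<alpha> then 4 * ?F r else 0) = 4 * ?F r" using 2 by simp
      ultimately show ?thesis unfolding eq i by linarith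
    next
      case 3
      then have "norm (ft q f (2 * r)) \<le> \<gamma>" using r by (simp add: spec_def)
      then have "?F r \<le> \<gamma>^2" by (intro power_mono) auto
      then have "?F r * (norm (?b (2 * r)))^2 * e^2 \<le> \<gamma>^2 * (norm (?b (2 * r)))^2 * 4"
        using esq by (intro mult_mono) auto
      moreover have "0 \<le> \<rho>^6 / 256 * ?F r" by simp
      moreover have i: "(if r \<in> spec q f \<gamma> - spec q f \<alpha> then 4 * ?F r else 0) = 0" using 3 by simp
      ultimately show ?thesis unfolding eq i by linarith
    qed
  qed
  have cB: "real (card B) > 0" using B by (simp add: card_gt_0_iff)
  have "(\<Sum>r\<in>?I. (norm (ft q (\<lambda>z. g (z + t) - g z) r))^2) = (\<Sum>r\<in>?I. (norm (ft q (\<lambda>z. g (z + t) - g z) (2 * r)))^2)"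
    by (rule sum_norm_ft_double[OF q, symmetric])
  also have "\<dots> \<le> (\<Sum>r\<in>?I. \<rho>^6 / 256 * ?F r + (if r \<in> spec q f \<gamma> - spec q f \<alpha> then 4 * ?F r else 0)
      + 4 * \<gamma>^2 * (norm (?b (2 * r)))^2)"
    by (rule sum_mono) (rule bound)
  also have "\<dots> = \<rho>^6 / 256 * (\<Sum>r\<in>?I. ?F r) + (\<Sum>r\<in>?I. if r \<in> spec q f \<gamma> - spec q f \<alpha> then 4 * ?F r else 0)
      + 4 * \<gamma>^2 * (\<Sum>r\<in>?I. (norm (?b (2 * r)))^2)"
    by (simp add: sum.distrib sum_distrib_left)
  also have "\<dots> \<le> \<rho>^6 / 256 * 1 + \<rho>^6 / 32 + \<rho>^6 / 64"
  proof (intro add_mono)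
    show "\<rho>^6 / 256 * (\<Sum>r\<in>?I. ?F r) \<le> \<rho>^6 / 256 * 1"
      using sum_norm_ft_le_1[of q f, OF q(1) f01] sum_norm_ft_double[OF q, of "\<lambda>z. (norm z)^2" f]
      by (intro mult_left_mono) auto
    have "(\<Sum>r\<in>?I. if r \<in> spec q f \<gamma> - spec q f \<alpha> then 4 * ?F r else 0) = (\<Sum>r\<in>?I \<inter> (spec q f \<gamma> - spec q f \<alpha>). 4 * ?F r)"
      by (rule sum.inter_restrict[symmetric]) simp
    also have "?I \<inter> (spec q f \<gamma> - spec q f \<alpha>) = spec q f \<gamma> - spec q f \<alpha>"
      by (auto simp: spec_def)
    finally show "(\<Sum>r\<in>?I. if r \<in> spec q f \<gamma> - spec q f \<alpha> then 4 * ?F r else 0) \<le> \<rho>^6 / 32"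
      using energy by (simp add: sum_distrib_left[symmetric])
    have "(\<Sum>r\<in>?I. (norm (?b (2 * r)))^2) = (\<Sum>r\<in>?I. (norm (?b r))^2)"
    proof (rule sum_double_mod[OF q, of "\<lambda>r. (norm (?b r))^2"], rule periodicI)
      fix r s assume rs: "r mod q = s mod q"
      have "ee q (- (r * j)) = ee q (- (s * j))" for j
        by (rule periodicD[OF periodic_ee[OF q(1)]]) (metis rs mod_minus_cong mod_mult_left_eq)
      then show "(norm (?b r))^2 = (norm (?b s))^2" by (simp add: mult_ft_def)
    qed
    also have "\<dots> = of_int q / real (card B)" by (rule sum_norm_mult_ft[OF q(1) B(1,2)])
    finally have eq: "(\<Sum>r\<in>?I. (norm (?b (2 * r)))^2) = of_int q / real (card B)" .
    have d: "0 < bohr_density \<beta>" "bohr_density \<beta> \<le> 1" using \<beta> bohr_density_pos bohr_density_le_1 by auto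
    have "\<gamma>^2 \<le> (bohr_density \<beta> * \<rho>^3 / 16)^2" using \<gamma> by (intro power_mono) auto
    also have "\<dots> = bohr_density \<beta> * bohr_density \<beta> * (\<rho>^6 / 256)"
      by (simp add: power_divide power_mult_distrib flip: power_mult) (simp add: power2_eq_square)
    also have "\<dots> \<le> bohr_density \<beta> * 1 * (\<rho>^6 / 256)"
      using d by (intro mult_right_mono mult_left_mono) auto
    finally have "4 * \<gamma>^2 * of_int q \<le> bohr_density \<beta> * of_int q * (\<rho>^6 / 64)"
      using q by (simp add: field_simps)
    also have "\<dots> \<le> real (card B) * (\<rho>^6 / 64)"
      using card_B by (intro mult_right_mono) auto
    finally show "4 * \<gamma>^2 * (\<Sum>r\<in>?I. (norm (?b (2 * r)))^2) \<le> \<rho>^6 / 64"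
      unfolding eq using cB by (simp add: field_simps)
  qed
  also have "\<dots> \<le> \<rho>^6 / 16" by simp
  finally have "of_int q * (\<Sum>r\<in>?I. (norm (ft q (\<lambda>z. g (z + t) - g z) r))^2) \<le> of_int q * (\<rho>^6 / 16)"
    using q by (intro mult_left_mono) auto
  moreover have "(\<Sum>z\<in>?I. (g (z + t) - g z)^2) = of_int q * (\<Sum>r\<in>?I. (norm (ft q (\<lambda>z. g (z + t) - g z) r))^2)"
    using q by (simp add: parseval[OF q(1)])
  ultimately show ?thesis by (simp add: mult.commute)
qed

text \<open>Cauchy-Schwarz in pointwise form: \<open>2 * \<bar>u\<bar> * l \<le> u^2 + l^2\<close>,
  with \<open>l\<close> chosen so that \<open>l * l\<close> is the mean square bound of
  \<open>shift_g_L2\<close>.\<close>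

lemma shift_g_L1:
  assumes t: "t \<in> bohr q (spec q f \<alpha>) (bohr_radius \<alpha>)"
  shows "(\<Sum>z\<in>{0..<q}. \<bar>g (z + t) - g z\<bar>) \<le> \<rho>^3 / 4 * of_int q"
proof -
  define l where "l = \<rho>^3 / 4"
  have l: "l > 0" using \<rho> by (simp add: l_def)
  have "\<bar>u\<bar> \<le> (u^2 / l + l) / 2" for u :: real
  proof -
    have "0 \<le> (\<bar>u\<bar> - l)^2" by simp
    then have "2 * \<bar>u\<bar> * l \<le> u^2 + l^2" by (simp add: power2_diff)
    then show ?thesis using l by (simp add: field_simps power2_eq_square)
  qed
  then have "(\<Sum>z\<in>{0..<q}. \<bar>g (z + t) - g z\<bar>) \<le> (\<Sum>z\<in>{0..<q}. ((g (z + t) - g z)^2 / l + l) / 2)"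
    by (intro sum_mono)
  also have "\<dots> = ((\<Sum>z\<in>{0..<q}. (g (z + t) - g z)^2) / l + of_int q * l) / 2"
    using q by (simp add: sum_divide_distrib[symmetric] sum.distrib)
  also have "\<dots> \<le> ((\<rho>^6 / 16 * of_int q) / l + of_int q * l) / 2"
    by (intro divide_right_mono add_right_mono shift_g_L2[OF t]) (use l in simp_all)
  also have "\<rho>^6 / 16 = l * l" by (simp add: l_def flip: power_add)
  finally show ?thesis using l by (simp add: l_def[symmetric] mult.commute)
qed

text \<open>For every difference \<open>t\<close> in the Bohr set at \<open>\<alpha>\<close>, the
  three factors nearly agree, so the sum over \<open>z\<close> is close to that of
  \<open>g z ^ 3\<close>. The many such \<open>t\<close> give the bound for \<open>g\<close>, and
  \<open>smoothing\<close> at level \<open>\<beta>\<close> returns it to \<open>f\<close>.\<close>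

lemma many_ap3: "bohr_density \<alpha> * \<rho>^3 / 4 * of_int q ^ 2 \<le> T3 q f"
proof -
  let ?I = "{0..<q}" and ?A = "bohr q (spec q f \<alpha>) (bohr_radius \<alpha>)"
  have cubes: "\<rho>^3 * of_int q \<le> (\<Sum>z\<in>?I. g z ^ 3)"
  proof -
    \<comment> \<open>The tangent to the cube at \<open>\<rho>\<close>. Its linear part has
      nonnegative sum, because averaging preserves the mean.\<close>
    have "\<rho>^3 + 3 * \<rho>^2 * (g z - \<rho>) \<le> g z ^ 3" for z
    proof -
      have "0 \<le> (g z - \<rho>)^2 * (g z + 2 * \<rho>)" using g01[of z] \<rho> by simp
      also have "\<dots> = g z ^ 3 - (\<rho>^3 + 3 * \<rho>^2 * (g z - \<rho>))"
        by (simp add: power2_eq_square power3_eq_cube algebra_simps)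
      finally show ?thesis by simp
    qed
    then have le: "(\<Sum>z\<in>?I. \<rho>^3 + 3 * \<rho>^2 * (g z - \<rho>)) \<le> (\<Sum>z\<in>?I. g z ^ 3)" by (intro sum_mono)
    have "(\<Sum>z\<in>?I. g z) = (\<Sum>z\<in>?I. f z)"
      unfolding g_def by (rule sum_avg_shift[OF q(1) f B(3,2)])
    then have "0 \<le> 3 * \<rho>^2 * ((\<Sum>z\<in>?I. g z) - (\<Sum>z\<in>?I. \<rho>))" using density q by (simp add: mult.commute)
    moreover have "(\<Sum>z\<in>?I. \<rho>^3 + 3 * \<rho>^2 * (g z - \<rho>)) = (\<Sum>z\<in>?I. \<rho>^3) + 3 * \<rho>^2 * ((\<Sum>z\<in>?I. g z) - (\<Sum>z\<in>?I. \<rho>))"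
      by (simp only: sum.distrib sum_subtractf flip: sum_distrib_left)
    ultimately have "(\<Sum>z\<in>?I. \<rho>^3) \<le> (\<Sum>z\<in>?I. g z ^ 3)" using le by argo
    then show ?thesis using q by (simp add: mult.commute)
  qed
  have inner: "\<rho>^3 / 2 * of_int q \<le> (\<Sum>z\<in>?I. g (z - t) * g z * g (z + t))" if t: "t \<in> ?A" for t
  proof -
    have pw: "g z ^ 3 - \<bar>g (z - t + t) - g (z - t)\<bar> - \<bar>g (z + t) - g z\<bar> \<le> g (z - t) * g z * g (z + t)" for z
    proof -
      have "g z ^ 3 - g (z - t) * g z * g (z + t) =
        g z * g z * (g z - g (z - t)) + g (z - t) * g z * (g z - g (z + t))"
        by (simp add: power3_eq_cube algebra_simps)
      also have "\<dots> \<le> \<bar>g z * g z * (g z - g (z - t))\<bar> + \<bar>g (z - t) * g z * (g z - g (z + t))\<bar>" by linarith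
      also have "\<dots> \<le> \<bar>g z - g (z - t)\<bar> + \<bar>g z - g (z + t)\<bar>"
        unfolding abs_mult using g01
        by (intro add_mono mult_left_le_one_le) (simp_all add: mult_le_one)
      finally show ?thesis by (simp add: abs_minus_commute)
    qed
    have per: "periodic q (\<lambda>z. \<bar>g (z + t) - g z\<bar>)"
      using periodicD[OF g] periodicD[OF periodic_shift[OF g]] by (intro periodicI) metis
    have "(\<Sum>z\<in>?I. \<bar>g (z - t + t) - g (z - t)\<bar>) = (\<Sum>z\<in>?I. \<bar>g (z + t) - g z\<bar>)"
      using sum_shift_mod[OF q(1) per, of "- t"] by simp
    then have "(\<Sum>z\<in>?I. g z ^ 3 - \<bar>g (z - t + t) - g (z - t)\<bar> - \<bar>g (z + t) - g z\<bar>)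
       = (\<Sum>z\<in>?I. g z ^ 3) - 2 * (\<Sum>z\<in>?I. \<bar>g (z + t) - g z\<bar>)"
      by (simp only: sum_subtractf)
    moreover have "(\<Sum>z\<in>?I. g z ^ 3 - \<bar>g (z - t + t) - g (z - t)\<bar> - \<bar>g (z + t) - g z\<bar>)
       \<le> (\<Sum>z\<in>?I. g (z - t) * g z * g (z + t))"
      by (rule sum_mono) (rule pw)
    ultimately show ?thesis using cubes shift_g_L1[OF t] by linarith
  qed
  have "bohr_density \<alpha> * of_int q * (\<rho>^3 / 2 * of_int q) \<le> real (card ?A) * (\<rho>^3 / 2 * of_int q)"
    using card_spec_bohr_ge[of q f, OF q f01 \<alpha>(1)] \<rho> q by (intro mult_right_mono) auto
  also have "\<dots> \<le> (\<Sum>t\<in>?A. \<Sum>z\<in>?I. g (z - t) * g z * g (z + t))"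
    using sum_bounded_below[of ?A "\<rho>^3 / 2 * of_int q"] inner by simp
  also have "\<dots> \<le> T3 q g"
    unfolding T3_def using g01 by (intro sum_mono2) (auto simp: bohr_def intro!: sum_nonneg)
  also have "\<dots> \<le> T3 q f + 2 * \<beta> * of_int q ^ 2"
  proof -
    have "\<bar>T3 q g - T3 q f\<bar> \<le> 2 * \<beta> * of_int q ^ 2"
      unfolding g_def
    proof (rule smoothing[OF q(1) f f01 B(3,2)])
      fix r j assume "r \<in> ?I" "\<beta> \<le> norm (ft q f (2 * r))" "j \<in> B"
      then have "norm (ee q (r * j) - 1) \<le> 2 * pi / real (bohr_radius \<beta>)"
        by (simp add: B_def bohr_def spec_def)
      then show "norm (ee q (r * j) - 1) \<le> \<beta> / 4" using bohr_radius_bound(2)[OF \<beta>(1)] by linarith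
    qed (use \<beta> in auto)
    then show ?thesis by linarith
  qed
  also have "2 * \<beta> * of_int q ^ 2 \<le> 2 * (bohr_density \<alpha> * \<rho>^3 / 16) * of_int q ^ 2"
    using \<beta> by (intro mult_right_mono mult_left_mono) auto
  finally have "bohr_density \<alpha> * of_int q * (\<rho>^3 / 2 * of_int q) \<le> T3 q f + bohr_density \<alpha> * \<rho>^3 / 8 * of_int q ^ 2"
    by simp
  moreover have "0 \<le> bohr_density \<alpha> * \<rho>^3 * of_int q ^ 2"
    using bohr_density_pos[OF \<alpha>(1)] \<rho> by simp
  moreover have "bohr_density \<alpha> * of_int q * (\<rho>^3 / 2 * of_int q) = bohr_density \<alpha> * \<rho>^3 * of_int q ^ 2 / 2"
    by (simp add: power2_eq_square)
  ultimately show ?thesis by argo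
qed

end

text \<open>Consecutive scales satisfy the inequalities that \<open>roth_setting\<close> imposes on
  \<open>\<alpha>\<close>, \<open>\<beta>\<close>, \<open>\<gamma>\<close>. Taking the minimum makes
  the sequence decrease, so that the spectra are nested.\<close>

primrec roth_scale :: "real \<Rightarrow> nat \<Rightarrow> real" where
  "roth_scale \<rho> 0 = \<rho>^3 / 8"
| "roth_scale \<rho> (Suc i) = min (roth_scale \<rho> i) (bohr_density (roth_scale \<rho> i) * \<rho>^3 / 16)"

lemma roth_scale_pos: "0 < \<rho> \<Longrightarrow> 0 < roth_scale \<rho> i"
  by (induction i) (simp_all add: bohr_density_pos)

lemma roth_scale_le: "roth_scale \<rho> i \<le> \<rho>^3 / 8"
  by (induction i) auto

text \<open>The energy of \<open>f\<close> on the nested spectra is at most 1, so among a bounded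
  number of scales some two-step gap carries little energy and \<open>many_ap3\<close> applies
  there. The constant is a minimum over those scales, fixed by \<open>\<rho>\<close>.\<close>

theorem roth_varnavides:
  assumes \<rho>: "0 < \<rho>" "\<rho> \<le> 1"
  shows "\<exists>m>0. \<forall>q f. 0 < q \<and> odd q \<and> periodic q f \<and> (\<forall>x. 0 \<le> f x \<and> f x \<le> 1) \<and>
    \<rho> * of_int q \<le> (\<Sum>x\<in>{0..<q}. f x) \<longrightarrow> m * of_int q ^ 2 \<le> T3 q f"
proof -
  let ?\<eta> = "roth_scale \<rho>"
  \<comment> \<open>Gaps of two steps overlap, so the total gain telescopes to
    \<open>E (n + 1) + E n - E 1 - E 0\<close>, at most 2. Hence the 2 in the choice of
    \<open>n\<close>.\<close>
  have "0 < \<rho>^6 / 128" using \<rho> by simp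
  then obtain n :: nat where n: "2 < real n * (\<rho>^6 / 128)"
    using reals_Archimedean3 by blast
  then have n0: "n > 0" using \<rho> by (cases n) auto
  define m where "m = Min ((\<lambda>i. bohr_density (?\<eta> i) * \<rho>^3 / 4) ` {..<n})"
  have m: "m \<le> bohr_density (?\<eta> i) * \<rho>^3 / 4" if "i < n" for i
    unfolding m_def using that by (intro Min_le) auto
  have "m \<in> (\<lambda>i. bohr_density (?\<eta> i) * \<rho>^3 / 4) ` {..<n}"
    unfolding m_def using n0 by (intro Min_in) auto
  then have "m > 0" using \<rho> roth_scale_pos[OF \<rho>(1)] by (auto simp: bohr_density_pos)
  moreover have "m * of_int q ^ 2 \<le> T3 q f"
    if q: "0 < q" "odd q" and f: "periodic q f" and f01: "\<And>x. 0 \<le> f x \<and> f x \<le> 1"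
      and d: "\<rho> * of_int q \<le> (\<Sum>x\<in>{0..<q}. f x)" for q f
  proof -
    define E where "E i = (\<Sum>r\<in>spec q f (?\<eta> i). (norm (ft q f (2 * r)))^2)" for i
    have E01: "0 \<le> E i" "E i \<le> 1" for i
    proof -
      have "E i \<le> (\<Sum>r\<in>{0..<q}. (norm (ft q f (2 * r)))^2)"
        unfolding E_def by (rule sum_mono2) (auto simp: spec_def)
      also have "\<dots> \<le> 1"
        using sum_norm_ft_le_1[of q f, OF q(1) f01] sum_norm_ft_double[OF q, of "\<lambda>z. (norm z)^2"] by simp
      finally show "E i \<le> 1" .
    qed (simp add: E_def sum_nonneg)
    have "\<exists>i<n. E (i + 2) - E i \<le> \<rho>^6 / 128"
    proof (rule ccontr)
      assume "\<not> ?thesis"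
      then have "\<forall>i<n. \<rho>^6 / 128 < E (i + 2) - E i" by auto
      then have "real (card {..<n}) * (\<rho>^6 / 128) \<le> (\<Sum>i<n. E (i + 2) - E i)"
        by (intro sum_bounded_below) (auto intro: less_imp_le)
      moreover have "(\<Sum>i<k. E (i + 2) - E i) = E (k + 1) + E k - E 1 - E 0" for k
        by (induction k) auto
      ultimately have "real n * (\<rho>^6 / 128) \<le> E (n + 1) + E n - E 1 - E 0" by simp
      then show False using n E01(2)[of "n + 1"] E01(2)[of n] E01(1)[of 0] E01(1)[of 1] by linarith
    qed
    then obtain i where i: "i < n" "E (i + 2) - E i \<le> \<rho>^6 / 128" by blast
    have "spec q f (?\<eta> i) \<subseteq> spec q f (?\<eta> (i + 2))" by (auto simp: spec_def)
    then have "(\<Sum>r\<in>spec q f (?\<eta> (i + 2)) - spec q f (?\<eta> i). (norm (ft q f (2 * r)))^2) = E (i + 2) - E i"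
      unfolding E_def by (intro sum_diff) auto
    then have en: "(\<Sum>r\<in>spec q f (?\<eta> (Suc (Suc i))) - spec q f (?\<eta> i). (norm (ft q f (2 * r)))^2) \<le> \<rho>^6 / 128"
      using i by simp
    have sc: "0 < ?\<eta> j" "?\<eta> (Suc j) \<le> bohr_density (?\<eta> j) * \<rho>^3 / 16" for j
      using roth_scale_pos[OF \<rho>(1)] by auto
    interpret roth_setting q f \<rho> "?\<eta> i" "?\<eta> (Suc i)" "?\<eta> (Suc (Suc i))"
      by unfold_locales (rule q f f01 conjunct1[OF f01] conjunct2[OF f01] \<rho> d sc roth_scale_le en)+
    have "m * of_int q ^ 2 \<le> bohr_density (?\<eta> i) * \<rho>^3 / 4 * of_int q ^ 2"
      by (intro mult_right_mono m[OF i(1)]) simp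
    then show ?thesis using many_ap3 by linarith
  qed
  ultimately show ?thesis by blast
qed

section \<open>Behrend's construction modulo q\<close>

lemma digits_unique:
  fixes x y :: "nat \<Rightarrow> nat"
  assumes "\<And>i. i < k \<Longrightarrow> x i < b \<and> y i < b" and "(\<Sum>i<k. x i * b ^ i) = (\<Sum>i<k. y i * b ^ i)"
  shows "i < k \<Longrightarrow> x i = y i"
  using assms
proof (induction k arbitrary: x y i)
  case (Suc k)
  have split: "(\<Sum>i<Suc k. u i * b ^ i) = u 0 + b * (\<Sum>i<k. u (Suc i) * b ^ i)" for u :: "nat \<Rightarrow> nat"
    by (simp add: sum.lessThan_Suc_shift sum_distrib_left mult_ac del: sum.lessThan_Suc)
  have lt: "x 0 < b" "y 0 < b" using Suc.prems(2) by auto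
  have eq: "x 0 + b * (\<Sum>i<k. x (Suc i) * b ^ i) = y 0 + b * (\<Sum>i<k. y (Suc i) * b ^ i)"
    using Suc.prems(3) unfolding split .
  then have "x 0 = y 0" using lt by (metis mod_less mod_mult_self2)
  with eq lt have tl: "(\<Sum>i<k. x (Suc i) * b ^ i) = (\<Sum>i<k. y (Suc i) * b ^ i)" by simp
  have "x (Suc j) = y (Suc j)" if "j < k" for j
    using Suc.IH[of j "\<lambda>i. x (Suc i)" "\<lambda>i. y (Suc i)"] that Suc.prems(2) tl by simp
  with \<open>x 0 = y 0\<close> show ?case using Suc.prems(1) by (cases i) auto
qed simp

lemma digit_sum_less:
  fixes x :: "nat \<Rightarrow> nat"
  assumes "\<And>i. i < k \<Longrightarrow> x i < b"
  shows "(\<Sum>i<k. x i * b ^ i) < b ^ k"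
  using assms
proof (induction k)
  case (Suc k)
  then have "(\<Sum>i<k. x i * b ^ i) < b ^ k" "x k + 1 \<le> b" by (auto simp: Suc_le_eq)
  then have "(\<Sum>i<k. x i * b ^ i) + x k * b ^ k < (x k + 1) * b ^ k" by simp
  also have "\<dots> \<le> b * b ^ k" using \<open>x k + 1 \<le> b\<close> by (intro mult_right_mono) auto
  finally show ?case by simp
qed simp

text \<open>Vectors with digits below \<open>m\<close> are read in base \<open>2 * m\<close>, so
  adding two of them produces no carry and progressions of numbers become progressions of vectors. A
  sphere contains no midpoint of two distinct points, and pigeonhole over fewer than
  \<open>k * m^2\<close> squared radii finds a large sphere.\<close>

lemma behrend:
  fixes k m :: nat
  assumes k: "k > 0" and m: "m > 0"
  shows "\<exists>B. B \<subseteq> {..<(2 * m) ^ k} \<and> m ^ k \<le> card B * (k * m^2) \<and>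
    (\<forall>x\<in>B. \<forall>y\<in>B. \<forall>z\<in>B. x + y = 2 * z \<longrightarrow> x = y)"
proof -
  let ?D = "PiE {..<k} (\<lambda>_. {..<m})"
  define val where "val x = (\<Sum>i<k. x i * (2 * m) ^ i)" for x :: "nat \<Rightarrow> nat"
  define sq where "sq x = (\<Sum>i<k. (x i)^2)" for x :: "nat \<Rightarrow> nat"
  have D: "x i < m" if "x \<in> ?D" "i < k" for x i using that by auto
  have fin: "finite ?D" by (simp add: finite_PiE)
  have sq: "sq x < k * m^2" if x: "x \<in> ?D" for x
  proof -
    have "sq x < (\<Sum>i<k. m^2)"
      unfolding sq_def using k D[OF x] by (intro sum_strict_mono) (auto intro!: power_strict_mono)
    then show ?thesis by simp
  qed
  have "\<exists>v. m ^ k \<le> card {x \<in> ?D. sq x = v} * (k * m^2)"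
  proof (rule ccontr)
    assume "\<not> ?thesis"
    then have "(\<Sum>v<k * m^2. card {x \<in> ?D. sq x = v} * (k * m^2)) < (\<Sum>v<k * m^2. m ^ k)"
      using k m by (intro sum_strict_mono) (auto simp: not_le lessThan_empty_iff)
    then have "(\<Sum>v<k * m^2. card {x \<in> ?D. sq x = v}) * (k * m^2) < m ^ k * (k * m^2)"
      by (subst sum_distrib_right) (simp add: mult_ac)
    then have "(\<Sum>v<k * m^2. card {x \<in> ?D. sq x = v}) < m ^ k" by simp
    moreover have "card ?D \<le> (\<Sum>v<k * m^2. card {x \<in> ?D. sq x = v})"
    proof -
      have "?D = (\<Union>v<k * m^2. {x \<in> ?D. sq x = v})" using sq by auto
      then show ?thesis using card_UN_le[of "{..<k * m^2}" "\<lambda>v. {x \<in> ?D. sq x = v}"] by simp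
    qed
    ultimately show False by (simp add: card_PiE)
  qed
  then obtain v where v: "m ^ k \<le> card {x \<in> ?D. sq x = v} * (k * m^2)" by blast
  let ?X = "{x \<in> ?D. sq x = v}"
  have inj: "inj_on val ?D"
  proof (rule inj_onI)
    fix x y assume xy: "x \<in> ?D" "y \<in> ?D" "val x = val y"
    have "x i = y i" if "i < k" for i
    proof (rule digits_unique[where b = "2 * m" and x = x and y = y and i = i])
      show "(\<Sum>i<k. x i * (2 * m) ^ i) = (\<Sum>i<k. y i * (2 * m) ^ i)" using xy(3) by (simp add: val_def)
      show "x j < 2 * m \<and> y j < 2 * m" if "j < k" for j using D[OF xy(1) that] D[OF xy(2) that] by simp
    qed (rule that)
    then show "x = y" using xy(1,2) by (intro PiE_ext) auto
  qed
  have "x = y" if xyz: "x \<in> ?X" "y \<in> ?X" "z \<in> ?X" "val x + val y = 2 * val z" for x y z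
  proof -
    have dig: "x i + y i = 2 * z i" if "i < k" for i
    proof (rule digits_unique[where b = "2 * m" and x = "\<lambda>i. x i + y i" and y = "\<lambda>i. 2 * z i" and i = i])
      show "(\<Sum>i<k. (x i + y i) * (2 * m) ^ i) = (\<Sum>i<k. 2 * z i * (2 * m) ^ i)"
        using xyz(4) by (simp add: val_def sum.distrib distrib_right sum_distrib_left mult.assoc)
      show "x j + y j < 2 * m \<and> 2 * z j < 2 * m" if "j < k" for j
        using D[of x j] D[of y j] D[of z j] xyz that by auto
    qed (rule that)
    \<comment> \<open>The parallelogram law: the squared distance of two points with midpoint
      \<open>z\<close> vanishes when all three lie on one sphere.\<close>
    have "(\<Sum>i<k. (int (x i) - int (y i))^2) = (\<Sum>i<k. 2 * (int (x i))^2 + 2 * (int (y i))^2 - 4 * (int (z i))^2)"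
    proof (rule sum.cong[OF refl])
      fix i assume "i \<in> {..<k}"
      then have "int (x i) + int (y i) = 2 * int (z i)" using dig[of i] by simp
      then have "(int (x i) + int (y i))^2 = 4 * (int (z i))^2" by (simp add: power_mult_distrib)
      then show "(int (x i) - int (y i))^2 = 2 * (int (x i))^2 + 2 * (int (y i))^2 - 4 * (int (z i))^2"
        by (simp add: power2_eq_square algebra_simps)
    qed
    also have "\<dots> = 2 * int (sq x) + 2 * int (sq y) - 4 * int (sq z)"
      by (simp add: sq_def sum.distrib sum_subtractf sum_distrib_left)
    also have "\<dots> = 0" using xyz by simp
    finally have "\<forall>i\<in>{..<k}. (int (x i) - int (y i))^2 = 0"
      by (subst (asm) sum_nonneg_eq_0_iff) auto
    then show "x = y" using xyz by (intro PiE_ext[of x "{..<k}" "\<lambda>_. {..<m}"]) auto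
  qed
  then have free: "\<forall>x\<in>val ` ?X. \<forall>y\<in>val ` ?X. \<forall>z\<in>val ` ?X. x + y = 2 * z \<longrightarrow> x = y"
    by blast
  have "val x < (2 * m) ^ k" if "x \<in> ?X" for x
  proof -
    have "x i < 2 * m" if "i < k" for i using D[of x i] \<open>x \<in> ?X\<close> that by simp
    then show ?thesis unfolding val_def by (rule digit_sum_less)
  qed
  then have "val ` ?X \<subseteq> {..<(2 * m) ^ k}" by (intro image_subsetI) (simp only: lessThan_iff)
  moreover have "card (val ` ?X) = card ?X"
    by (rule card_image, rule inj_on_subset[OF inj]) simp
  ultimately show ?thesis using v free by (intro exI[of _ "val ` ?X"] conjI) (simp_all only:)
qed

text \<open>Each element of a progression-free \<open>B \<subseteq> {..<N}\<close> is blown up to an interval of length \<open>l\<close>,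
  with gaps of the same length, inside the first half of \<open>{0..<q}\<close>: all progressions of the
  resulting set have their three terms in one interval.\<close>
lemma blow_up_ap3_count:
  fixes q l N :: nat
  assumes B: "B \<subseteq> {..<N}" and free: "\<forall>x\<in>B. \<forall>y\<in>B. \<forall>z\<in>B. x + y = 2 * z \<longrightarrow> x = y"
    and l: "l > 0" "4 * (l * N) \<le> q"
  defines "S \<equiv> {x. x div (2 * l) \<in> B \<and> x mod (2 * l) < l}"
  shows "S \<subseteq> {0..<q}" "card S = card B * l" "ap3_count q S \<le> card B * (l * l)"
proof -
  have half: "2 * x < q" if "x \<in> S" for x
  proof -
    have "x div (2 * l) + 1 \<le> N" using that B by (auto simp: S_def)
    then have "(x div (2 * l) + 1) * (2 * l) \<le> N * (2 * l)" by (rule mult_right_mono) simp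
    moreover have "x < (x div (2 * l) + 1) * (2 * l)"
      using l dividend_less_div_times[of "2 * l" x] by simp
    ultimately show ?thesis using l(2) by (simp add: mult_ac)
  qed
  then show "S \<subseteq> {0..<q}" by fastforce
  then have finS: "finite S" using finite_subset by blast
  have finB: "finite B" using B finite_subset by blast
  have "bij_betw (\<lambda>x. (x div (2 * l), x mod (2 * l))) S (B \<times> {..<l})"
  proof (rule bij_betwI[where g = "\<lambda>(a, y). a * (2 * l) + y"])
    show "(\<lambda>(a, y). a * (2 * l) + y) \<in> B \<times> {..<l} \<rightarrow> S"
      using l by (auto simp: S_def)
  qed (use l in \<open>auto simp: S_def intro: div_mult_mod_eq\<close>)
  then show "card S = card B * l" by (simp add: bij_betw_same_card card_cartesian_product)
  let ?P = "{(a,b,c). a \<in> S \<and> b \<in> S \<and> c \<in> S \<and> (a + b) mod q = (2 * c) mod q}"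
  \<comment> \<open>A progression is determined by the block of \<open>a\<close> and the offsets of
    \<open>a\<close> and \<open>b\<close>: both lie in one block, and they fix
    \<open>c\<close>.\<close>
  let ?\<phi> = "\<lambda>(a,b,c). (a div (2 * l), a mod (2 * l), b mod (2 * l))"
  have eq: "a + b = 2 * c" "a div (2 * l) = b div (2 * l)"
    if h: "a \<in> S" "b \<in> S" "c \<in> S" "(a + b) mod q = (2 * c) mod q" for a b c
  proof -
    \<comment> \<open>All elements lie below \<open>q / 2\<close>, so the congruence is an equality
      of integers.\<close>
    show abc: "a + b = 2 * c" using h half[of a] half[of b] half[of c] by simp
    define a1 a0 b1 b0 c1 c0 where d: "a1 = a div (2 * l)" "a0 = a mod (2 * l)" "b1 = b div (2 * l)"
      "b0 = b mod (2 * l)" "c1 = c div (2 * l)" "c0 = c mod (2 * l)"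
    have e: "a = 2 * l * a1 + a0" "b = 2 * l * b1 + b0" "c = 2 * l * c1 + c0" by (simp_all add: d)
    have lt: "a0 < l" "b0 < l" "c0 < l" using h by (simp_all add: S_def d)
    have *: "2 * l * (a1 + b1) + (a0 + b0) = 2 * l * (2 * c1) + 2 * c0"
      using abc unfolding e by (simp add: algebra_simps)
    \<comment> \<open>Offsets are below \<open>l\<close>, so their sums stay below the block period
      \<open>2 * l\<close> and nothing is carried into the block index.\<close>
    have "a1 + b1 = (2 * l * (a1 + b1) + (a0 + b0)) div (2 * l)" using lt by simp
    also have "\<dots> = 2 * c1 + (2 * c0) div (2 * l)"
      unfolding * using l by (intro div_mult_self4) simp
    also have "(2 * c0) div (2 * l) = 0" using lt by (intro div_less) simp
    finally have "a1 + b1 = 2 * c1" by simp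
    then show "a div (2 * l) = b div (2 * l)" using free h by (auto simp: S_def d)
  qed
  have "inj_on ?\<phi> ?P"
  proof (rule inj_onI)
    fix s t assume "s \<in> ?P" "t \<in> ?P" and st: "?\<phi> s = ?\<phi> t"
    then obtain a b c a' b' c' where s: "s = (a,b,c)" "a \<in> S" "b \<in> S" "c \<in> S" "(a + b) mod q = (2 * c) mod q"
      and t: "t = (a',b',c')" "a' \<in> S" "b' \<in> S" "c' \<in> S" "(a' + b') mod q = (2 * c') mod q" by auto
    have dm: "x = y" if "x div (2 * l) = y div (2 * l)" "x mod (2 * l) = y mod (2 * l)" for x y :: nat
      using that by (metis div_mult_mod_eq)
    from st have st': "a div (2 * l) = a' div (2 * l)" "a mod (2 * l) = a' mod (2 * l)" "b mod (2 * l) = b' mod (2 * l)"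
      unfolding s(1) t(1) by (simp_all only: prod.case prod.inject)
    have "b div (2 * l) = b' div (2 * l)" using eq(2)[OF s(2-5)] eq(2)[OF t(2-5)] st'(1) by argo
    then have "b = b'" using st'(3) by (rule dm)
    moreover have "a = a'" using st'(1,2) by (rule dm)
    ultimately show "s = t" using eq(1)[OF s(2-5)] eq(1)[OF t(2-5)] s(1) t(1) by simp
  qed
  moreover have "?\<phi> ` ?P \<subseteq> B \<times> {..<l} \<times> {..<l}" by (auto simp: S_def)
  ultimately have "card ?P \<le> card (B \<times> {..<l} \<times> {..<l})" by (rule card_inj_on_le) (simp add: finB)
  then show "ap3_count q S \<le> card B * (l * l)" by (simp add: ap3_count_def card_cartesian_product)
qed

text \<open>Behrend's set with \<open>m = 2 ^ k\<close>. The density loses \<open>2 ^ k\<close> to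
  the doubled base, at most \<open>2 ^ (3 * k)\<close> to the pigeonhole and a factor 8 to the
  blow-up; the proportion of progressions is at most \<open>1 / N\<close>, with
  \<open>N = 2 ^ (k * (k + 1))\<close>.\<close>

lemma behrend_mod:
  assumes k: "k > 0" and q: "4 * 2 ^ (k * (k + 1)) \<le> q"
  shows "\<exists>S \<subseteq> {0..<q}. real q \<le> real (card S) * 2 ^ (7 * k) \<and> mu q S * 2 ^ (k * k) \<le> 1"
proof -
  define m :: nat where "m = 2 ^ k"
  define N :: nat where "N = (2 * m) ^ k"
  have N: "N = 2 ^ (k * (k + 1))"
    by (simp add: N_def m_def mult.commute flip: power_Suc power_mult)
  obtain B where B: "B \<subseteq> {..<N}" "m ^ k \<le> card B * (k * m^2)"
    and free: "\<forall>x\<in>B. \<forall>y\<in>B. \<forall>z\<in>B. x + y = 2 * z \<longrightarrow> x = y"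
    using behrend[OF k, of m] by (auto simp: N_def m_def)
  define l where "l = q div (4 * N)"
  have "4 * N > 0" "4 * N \<le> q" using q by (simp_all add: N)
  then have l: "l > 0" "4 * (l * N) \<le> q" "q \<le> 8 * (l * N)"
  proof -
    show l0: "l > 0" using \<open>4 * N > 0\<close> \<open>4 * N \<le> q\<close> by (simp add: l_def div_greater_zero_iff)
    have "l * (4 * N) \<le> q" unfolding l_def by simp
    then show "4 * (l * N) \<le> q" by (simp add: mult_ac)
    have "q < (l + 1) * (4 * N)" unfolding l_def using dividend_less_div_times[OF \<open>4 * N > 0\<close>, of q] by simp
    also have "\<dots> \<le> (2 * l) * (4 * N)" using l0 by (intro mult_right_mono) auto
    finally show "q \<le> 8 * (l * N)" by (simp add: mult_ac)
  qed
  define S where "S = {x. x div (2 * l) \<in> B \<and> x mod (2 * l) < l}"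
  note S = blow_up_ap3_count[OF B(1) free l(1,2), folded S_def]
  have "N = 2 ^ k * m ^ k" by (simp add: N_def power_mult_distrib)
  also have "\<dots> \<le> 2 ^ k * (card B * (k * m^2))" using B(2) by simp
  also have "\<dots> \<le> 2 ^ k * (card B * (2 ^ k * m^2))" using less_exp[of k] by (intro mult_left_mono mult_right_mono) auto
  also have "\<dots> = card B * 2 ^ (4 * k)"
    by (simp add: m_def power_add[symmetric] power_mult[symmetric] mult_2_right flip: power_add)
  finally have "8 * (l * N) \<le> 8 * (l * (card B * 2 ^ (4 * k)))" by simp
  also have "\<dots> = card S * (2 ^ (4 * k) * 2 ^ 3)" unfolding S(2) by (simp add: mult_ac)
  also have "\<dots> \<le> card S * 2 ^ (7 * k)"
    unfolding power_add[symmetric] using k by (intro mult_left_mono power_increasing) auto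
  finally have "q \<le> card S * 2 ^ (7 * k)" using l(3) by linarith
  then have "real q \<le> real (card S * 2 ^ (7 * k))" by (simp only: of_nat_le_iff)
  moreover have "mu q S * 2 ^ (k * k) \<le> 1"
  proof -
    have "card B \<le> N" using B(1) card_mono[of "{..<N}" B] by simp
    have "ap3_count q S * 2 ^ (k * k) \<le> N * (l * l) * N"
      using S(3) \<open>card B \<le> N\<close> by (intro mult_mono order_trans[OF S(3)]) (auto simp: N)
    also have "\<dots> = (l * N) * (l * N)" by (simp add: mult_ac)
    also have "\<dots> \<le> q * q" using l(2) by (intro mult_mono) auto
    finally have "real (ap3_count q S * 2 ^ (k * k)) \<le> real (q * q)" by (simp only: of_nat_le_iff)
    moreover have "q > 0" using q by (cases q) auto
    ultimately show ?thesis by (simp add: mu_def power2_eq_square field_simps)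
  qed
  ultimately show ?thesis using S(1) by auto
qed

section \<open>Level sets and translates of averages\<close>

definition ind :: "nat \<Rightarrow> nat set \<Rightarrow> int \<Rightarrow> real" where
  "ind q S x = (if nat (x mod int q) \<in> S then 1 else 0)"

lemma periodic_ind: "periodic (int q) (ind q S)"
  by (rule periodicI) (simp add: ind_def)

lemma ind_01: "0 \<le> ind q S x \<and> ind q S x \<le> 1"
  by (simp add: ind_def)

lemma sum_int_interval: "(\<Sum>x\<in>{0..<int q}. F x) = (\<Sum>x\<in>{0..<q}. F (int x))"
  using sum.reindex[of int "{0..<q}" F] by (simp add: image_int_atLeastLessThan)

lemma sum_of_bool_card:
  "finite I \<Longrightarrow> (\<Sum>x\<in>I. if x \<in> A then 1 else 0 :: real) = real (card (I \<inter> A))"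
  by (subst sum.inter_restrict[symmetric]) auto

lemma ind_of_nat: "x < q \<Longrightarrow> ind q S (int x) = (if x \<in> S then 1 else 0)"
  by (simp add: ind_def)

lemma sum_ind:
  assumes "S \<subseteq> {0..<q}"
  shows "(\<Sum>x\<in>{0..<int q}. ind q S x) = real (card S)"
proof -
  have "(\<Sum>x\<in>{0..<int q}. ind q S x) = (\<Sum>x\<in>{0..<q}. if x \<in> S then 1 else 0)"
    unfolding sum_int_interval by (intro sum.cong) (auto simp: ind_of_nat)
  also have "\<dots> = real (card ({0..<q} \<inter> S))" by (rule sum_of_bool_card) simp
  finally show ?thesis using assms by (simp add: Int_absorb1)
qed

lemma T3_ind:
  assumes q: "q > 0" and S: "S \<subseteq> {0..<q}"
  shows "T3 (int q) (ind q S) = mu q S * real q ^ 2"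
proof -
  let ?I = "{0..<q}"
  let ?P = "{(a,b,c). a \<in> S \<and> b \<in> S \<and> c \<in> S \<and> (a + b) mod q = (2 * c) mod q}"
  have cong: "int q dvd (int x + int y - 2 * int z) \<longleftrightarrow> (x + y) mod q = (2 * z) mod q" for x y z
  proof -
    have "int q dvd (int x + int y - 2 * int z) \<longleftrightarrow> int (x + y) mod int q = int (2 * z) mod int q"
      by (simp add: mod_eq_dvd_iff)
    also have "\<dots> \<longleftrightarrow> int ((x + y) mod q) = int ((2 * z) mod q)" by (simp only: zmod_int)
    finally show ?thesis by (simp only: of_nat_eq_iff)
  qed
  have "T3 (int q) (ind q S) =
    (\<Sum>x\<in>?I. \<Sum>z\<in>?I. \<Sum>y\<in>?I. if (x, y, z) \<in> ?P then 1 else 0)"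
    unfolding T3_eq_sum[OF _ periodic_ind, of q S, simplified, OF q] sum_int_interval
    by (intro sum.cong refl) (auto simp: cong ind_of_nat)
  also have "\<dots> = (\<Sum>x\<in>?I. \<Sum>y\<in>?I. \<Sum>z\<in>?I. if (x, y, z) \<in> ?P then 1 else 0)"
    by (intro sum.cong refl sum.swap)
  also have "\<dots> = (\<Sum>p\<in>?I \<times> ?I \<times> ?I. if p \<in> ?P then 1 else 0)"
    by (simp add: sum.cartesian_product case_prod_unfold)
  also have "\<dots> = real (card ((?I \<times> ?I \<times> ?I) \<inter> ?P))"
    by (rule sum_of_bool_card) simp
  also have "(?I \<times> ?I \<times> ?I) \<inter> ?P = ?P" using S by auto
  finally show ?thesis using q by (simp add: mu_def ap3_count_def)
qed

lemma finite_mu_image: "finite {mu q S | S. S \<subseteq> {0..<q} \<and> real (card S) \<ge> \<rho> * real q}"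
  by (rule finite_subset[of _ "mu q ` Pow {0..<q}"]) auto

lemma r_min_le: "S \<subseteq> {0..<q} \<Longrightarrow> \<rho> * real q \<le> real (card S) \<Longrightarrow> r_min q \<rho> \<le> mu q S"
  unfolding r_min_def by (rule Min_le[OF finite_mu_image]) auto

lemma r_min_ge:
  assumes "\<rho> \<le> 1" and "\<And>S. S \<subseteq> {0..<q} \<Longrightarrow> \<rho> * real q \<le> real (card S) \<Longrightarrow> m \<le> mu q S"
  shows "m \<le> r_min q \<rho>"
proof -
  have "\<rho> * real q \<le> 1 * real q" using assms(1) by (intro mult_right_mono) auto
  \<comment> \<open>As \<open>\<rho> \<le> 1\<close>, the full set of residues is admissible, so the
    minimum is over a nonempty set and is attained.\<close>
  then have "mu q {0..<q} \<in> {mu q S | S. S \<subseteq> {0..<q} \<and> real (card S) \<ge> \<rho> * real q}" by auto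
  then have "{mu q S | S. S \<subseteq> {0..<q} \<and> real (card S) \<ge> \<rho> * real q} \<noteq> {}" by blast
  from Min_in[OF finite_mu_image this]
  show ?thesis using assms(2) unfolding r_min_def by auto
qed

text \<open>The sum starts at \<open>k = 2\<close>, so the weights add up to 1 and the bound is an equality at \<open>u = 1\<close>.
  This is why the target is \<open>2u - u\<^sup>2\<close>, which is also 1 there, and not \<open>2u\<close>.\<close>
lemma layer_bound:
  fixes u :: real
  assumes u: "0 \<le> u" "u \<le> 1" and K: "1 \<le> K"
  shows "2 * u - u^2 \<le> (\<Sum>k=2..K. 2 * (1/2)^k * (if (1/2)^k \<le> u then 1 else 0)) + 2 * (1/2)^K"
  using K
proof (induction K rule: nat_induct_at_least)
  case base
  have "0 \<le> (1 - u)^2" by simp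
  then show ?case by (simp add: power2_eq_square algebra_simps)
next
  case (Suc K)
  let ?s = "\<lambda>K. \<Sum>k=2..K. 2 * (1/2)^k * (if (1/2)^k \<le> u then 1 else 0 :: real)"
  have s: "?s (Suc K) = ?s K + 2 * (1/2)^Suc K * (if (1/2)^Suc K \<le> u then 1 else 0)"
    using Suc.hyps by simp
  show ?case
  proof (cases "(1/2)^Suc K \<le> u")
    case True
    then have "?s (Suc K) + 2 * (1/2)^Suc K = ?s K + 2 * (1/2)^K" unfolding s by simp
    then show ?thesis using Suc.IH by linarith
  next
    case False
    moreover have "0 \<le> ?s (Suc K)" by (intro sum_nonneg) auto
    moreover have "0 \<le> u^2" by simp
    ultimately show ?thesis by linarith
  qed
qed

lemma energy_le_level_sets:
  fixes f :: "nat \<Rightarrow> real"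
  assumes f: "\<And>x. 0 \<le> f x \<and> f x \<le> 1" and K: "1 \<le> K"
  shows "(\<Sum>x<q. 2 * f x - (f x)^2) \<le> (\<Sum>k=2..K. 2 * (1/2)^k * real (card {x. x < q \<and> (1/2)^k \<le> f x})) + 2 * (1/2)^K * real q"
proof -
  have "(\<Sum>x<q. 2 * f x - (f x)^2) \<le>
    (\<Sum>x<q. (\<Sum>k=2..K. 2 * (1/2)^k * (if (1/2)^k \<le> f x then 1 else 0)) + 2 * (1/2)^K)"
    by (intro sum_mono layer_bound K) (use f in auto)
  also have "\<dots> = (\<Sum>k=2..K. \<Sum>x<q. 2 * (1/2)^k * (if (1/2)^k \<le> f x then 1 else 0)) + real q * (2 * (1/2)^K)"
    unfolding sum.distrib by (subst sum.swap) simp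
  also have "(\<Sum>k=2..K. \<Sum>x<q. 2 * (1/2)^k * (if (1/2)^k \<le> f x then 1 else 0)) =
    (\<Sum>k=2..K. 2 * (1/2)^k * real (card {x. x < q \<and> (1/2)^k \<le> f x}))"
  proof (intro sum.cong refl)
    fix k
    have "(\<Sum>x<q. if (1/2)^k \<le> f x then 1 else 0 :: real) = real (card ({..<q} \<inter> {x. (1/2)^k \<le> f x}))"
      by (simp add: sum.If_cases)
    also have "{..<q} \<inter> {x. (1/2)^k \<le> f x} = {x. x < q \<and> (1/2)^k \<le> f x}" by auto
    finally show "(\<Sum>x<q. 2 * (1/2)^k * (if (1/2)^k \<le> f x then 1 else 0)) =
      2 * (1/2)^k * real (card {x. x < q \<and> (1/2)^k \<le> f x})"
      by (simp only: sum_distrib_left[symmetric])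
  qed
  finally show ?thesis by (simp add: mult.commute)
qed

text \<open>\<open>f\<close> dominates \<open>h\<close> times the indicator of its level set, and
  \<open>T3\<close> is monotone on nonnegative functions and homogeneous of degree 3.\<close>

lemma T3_level_set:
  assumes q: "q > 0" and f: "periodic (int q) f" "\<And>x. 0 \<le> f x" and h: "0 \<le> h"
  shows "h^3 * (mu q {x. x < q \<and> h \<le> f (int x)} * real q ^ 2) \<le> T3 (int q) f"
proof -
  let ?A = "{x. x < q \<and> h \<le> f (int x)}"
  have le: "h * ind q ?A x \<le> f x" for x
  proof -
    have "f x = f (x mod int q)" using f(1) by (simp add: periodic_def)
    moreover have "x mod int q \<ge> 0" using q by simp
    ultimately show ?thesis using f(2)[of x] by (auto simp: ind_def)
  qed
  have nn: "0 \<le> h * ind q ?A x" for x using h ind_01[of q ?A x] by simp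
  have "h^3 * T3 (int q) (ind q ?A) = T3 (int q) (\<lambda>x. h * ind q ?A x)"
    unfolding T3_def sum_distrib_left by (simp add: power3_eq_cube mult_ac)
  also have "\<dots> \<le> T3 (int q) f"
    unfolding T3_def by (intro sum_mono mult_mono le nn mult_nonneg_nonneg f(2))
  finally show ?thesis by (subst (asm) T3_ind[OF q]) auto
qed

text \<open>If the average of a set over a progression is nearly \<open>{0,1}\<close>-valued in mean square, the
  set is nearly invariant under most, hence by subadditivity under all, short steps.\<close>
lemma translation_invariance:
  fixes q M t :: nat and b :: int
  assumes q: "q > 0" and S: "S \<subseteq> {0..<q}" and M: "M > 0" and t: "2 * t \<le> M"
  defines "F \<equiv> ind q S"
  defines "g \<equiv> avg_shift {..<M} (\<lambda>j. b * int j) F"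
  shows "real (card S) - 4 * (real (card S) - (\<Sum>x\<in>{0..<int q}. (g x)^2)) \<le> (\<Sum>x\<in>{0..<int q}. F x * F (x + b * int t))"
proof -
  let ?I = "{0..<int q}"
  let ?s = "real (card S)"
  have q': "int q > 0" using q by simp
  have per: "periodic (int q) F" unfolding F_def by (rule periodic_ind)
  have F01: "F x = 0 \<or> F x = 1" for x by (simp add: F_def ind_def)
  \<comment> \<open>The size of the symmetric difference of two translates: a pseudometric in
    \<open>m\<close> and \<open>n\<close>.\<close>
  define D where "D m n = (\<Sum>x\<in>?I. \<bar>F (x + b * int m) - F (x + b * int n)\<bar>)" for m n :: nat
  have sumF: "(\<Sum>x\<in>?I. F (x + a)) = ?s" for a
    using sum_shift_mod[OF q' per, of a] sum_ind[OF S] by (simp add: F_def)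
  have D_eq: "D m n = 2 * ?s - 2 * (\<Sum>x\<in>?I. F (x + b * int m) * F (x + b * int n))" for m n
  proof -
    have "D m n = (\<Sum>x\<in>?I. F (x + b * int m) + F (x + b * int n) - 2 * (F (x + b * int m) * F (x + b * int n)))"
      unfolding D_def
    proof (rule sum.cong[OF refl])
      fix x show "\<bar>F (x + b * int m) - F (x + b * int n)\<bar> =
        F (x + b * int m) + F (x + b * int n) - 2 * (F (x + b * int m) * F (x + b * int n))"
        using F01[of "x + b * int m"] F01[of "x + b * int n"] by auto
    qed
    then show ?thesis by (simp add: sum_subtractf sum.distrib sumF sum_distrib_left)
  qed
  have D0: "0 \<le> D m n" for m n by (simp add: D_def sum_nonneg)
  have tri: "D n n' \<le> D m n + D m n'" for m n n'
    unfolding D_def sum.distrib[symmetric] by (intro sum_mono) linarith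
  have shift: "D n (n + t) = D 0 t" for n
  proof -
    have "periodic (int q) (\<lambda>x. \<bar>F x - F (x + b * int t)\<bar>)"
      using periodicD[OF per] periodicD[OF periodic_shift[OF per]] by (intro periodicI) metis
    from sum_shift_mod[OF q' this, of "b * int n"] show ?thesis
      by (simp add: D_def algebra_simps)
  qed
  \<comment> \<open>The square of the average expands into pair correlations, so the mean of
    \<open>D\<close> over all pairs is twice the deficit of the energy of \<open>g\<close>.\<close>
  have g2: "(\<Sum>m<M. \<Sum>n<M. D m n) = 2 * real M ^ 2 * (?s - (\<Sum>x\<in>?I. (g x)^2))"
  proof -
    have Mg: "real M * g x = (\<Sum>m<M. F (x + b * int m))" for x
      using M by (simp add: g_def avg_shift_def)
    have "real M ^ 2 * (\<Sum>x\<in>?I. (g x)^2) = (\<Sum>x\<in>?I. (\<Sum>m<M. F (x + b * int m)) * (\<Sum>n<M. F (x + b * int n)))"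
      unfolding Mg[symmetric] by (simp add: sum_distrib_left power2_eq_square mult_ac)
    also have "\<dots> = (\<Sum>m<M. \<Sum>n<M. \<Sum>x\<in>?I. F (x + b * int m) * F (x + b * int n))"
      unfolding sum_product by (subst sum.swap, rule sum.cong[OF refl], rule sum.swap)
    finally have eq: "(\<Sum>m<M. \<Sum>n<M. \<Sum>x\<in>?I. F (x + b * int m) * F (x + b * int n)) = real M ^ 2 * (\<Sum>x\<in>?I. (g x)^2)" by simp
    have "(\<Sum>m<M. \<Sum>n<M. D m n) = (\<Sum>m<M. \<Sum>n<M. 2 * ?s) - 2 * (\<Sum>m<M. \<Sum>n<M. \<Sum>x\<in>?I. F (x + b * int m) * F (x + b * int n))"
      unfolding D_eq by (simp only: sum_subtractf sum_distrib_left)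
    then show ?thesis unfolding eq by (simp add: power2_eq_square algebra_simps)
  qed
  \<comment> \<open>The distance \<open>D 0 t\<close> equals \<open>D n (n + t)\<close>, which is
    bounded through every intermediate \<open>m\<close>. Averaging over \<open>m\<close> and
    \<open>n\<close> loses at most a factor 2, since \<open>t\<close> is at most half of
    \<open>M\<close>.\<close>
  have "real M * real (M - t) * D 0 t = (\<Sum>m<M. \<Sum>n<M - t. D n (n + t))"
    by (simp add: shift)
  also have "\<dots> \<le> (\<Sum>m<M. \<Sum>n<M - t. D m n + D m (n + t))"
    by (intro sum_mono tri)
  also have "\<dots> \<le> (\<Sum>m<M. (\<Sum>n<M. D m n) + (\<Sum>n<M. D m n))"
  proof (intro sum_mono)
    fix m
    have "(\<Sum>n<M - t. D m n) \<le> (\<Sum>n<M. D m n)" by (intro sum_mono2) (auto simp: D0)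
    moreover have "(\<Sum>n<M - t. D m (n + t)) = (\<Sum>n\<in>(\<lambda>n. n + t) ` {..<M - t}. D m n)"
      by (subst sum.reindex) auto
    moreover have "(\<Sum>n\<in>(\<lambda>n. n + t) ` {..<M - t}. D m n) \<le> (\<Sum>n<M. D m n)"
      by (intro sum_mono2) (auto simp: D0)
    ultimately show "(\<Sum>n<M - t. D m n + D m (n + t)) \<le> (\<Sum>n<M. D m n) + (\<Sum>n<M. D m n)"
      by (simp add: sum.distrib)
  qed
  also have "\<dots> = 4 * real M ^ 2 * (?s - (\<Sum>x\<in>?I. (g x)^2))"
    unfolding sum.distrib g2 by simp
  finally have "real M * real (M - t) * D 0 t \<le> 4 * real M ^ 2 * (?s - (\<Sum>x\<in>?I. (g x)^2))" .
  moreover have "real M * (real M / 2) * D 0 t \<le> real M * real (M - t) * D 0 t"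
    using t by (intro mult_right_mono mult_left_mono D0) auto
  moreover have "real M * (real M / 2) * D 0 t = real M ^ 2 * D 0 t / 2"
    by (simp add: power2_eq_square)
  ultimately have "real M ^ 2 * D 0 t \<le> real M ^ 2 * (8 * (?s - (\<Sum>x\<in>?I. (g x)^2)))"
    by argo
  then have "D 0 t \<le> 8 * (?s - (\<Sum>x\<in>?I. (g x)^2))" using M by simp
  then show ?thesis unfolding D_eq by simp
qed

lemma card_shift_mod:
  assumes q: "q > 0" and S: "S \<subseteq> {0..<q}"
  shows "real (card (S \<inter> shift_mod q S a)) = (\<Sum>x\<in>{0..<int q}. ind q S x * ind q S (x + int a))"
proof -
  have mem: "x \<in> shift_mod q S a \<longleftrightarrow> ind q S (int x - int a) = 1" if "x < q" for x
  proof
    assume "x \<in> shift_mod q S a"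
    then obtain s where s: "s \<in> S" "x = (s + a) mod q" by (auto simp: shift_mod_def)
    have "(int x - int a) mod int q = int s mod int q"
      unfolding s(2) by (simp add: zmod_int mod_diff_left_eq)
    also have "\<dots> = int s" using s S by auto
    finally show "ind q S (int x - int a) = 1" using s by (simp add: ind_def)
  next
    assume "ind q S (int x - int a) = 1"
    then have s: "nat ((int x - int a) mod int q) \<in> S" by (simp add: ind_def split: if_splits)
    have "int ((nat ((int x - int a) mod int q) + a) mod q) = ((int x - int a) mod int q + int a) mod int q"
      using q by (simp add: zmod_int)
    also have "\<dots> = int x" using that by (simp add: mod_add_left_eq)
    finally show "x \<in> shift_mod q S a" using s unfolding shift_mod_def by (metis image_eqI of_nat_eq_iff)
  qed
  have "real (card (S \<inter> shift_mod q S a)) = real (card ({0..<q} \<inter> (S \<inter> shift_mod q S a)))"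
    using S by (simp add: Int_absorb1 inf.coboundedI1 le_infI1)
  also have "\<dots> = (\<Sum>x\<in>{0..<q}. if x \<in> S \<inter> shift_mod q S a then 1 else 0)"
    by (rule sum_of_bool_card[symmetric]) simp
  also have "\<dots> = (\<Sum>x\<in>{0..<q}. ind q S (int x) * ind q S (int x - int a))"
    by (intro sum.cong refl) (auto simp: ind_of_nat mem ind_def)
  also have "\<dots> = (\<Sum>x\<in>{0..<int q}. ind q S x * ind q S (x - int a))"
    by (simp add: sum_int_interval)
  also have "\<dots> = (\<Sum>x\<in>{0..<int q}. ind q S (x + int a) * ind q S (x + int a - int a))"
  proof (rule sum_shift_mod[symmetric])
    have "periodic (int q) (\<lambda>x. ind q S (x + - int a))" by (rule periodic_shift[OF periodic_ind])
    then show "periodic (int q) (\<lambda>x. ind q S x * ind q S (x - int a))"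
      using periodic_ind[of q S] by (simp add: periodic_def)
  qed (use q in simp)
  finally show ?thesis by (simp add: mult.commute)
qed

text \<open>Dirichlet's theorem in Bohr set form: \<open>q\<close> exceeds the number of cells, so
  the Bohr set has a nonzero element \<open>b\<close>. The phase of a multiple \<open>b * j\<close>
  is worse by a factor \<open>j < M\<close>, which the choice of \<open>N\<close> against
  \<open>M\<close> allows for.\<close>

lemma exists_good_step:
  fixes q :: nat
  assumes q: "odd q" and f01: "\<And>x. 0 \<le> f x \<and> f x \<le> 1" and \<eta>: "0 < \<eta>"
    and N: "0 < N" "N ^ nat \<lceil>1 / \<eta>^2\<rceil> < q" and M: "2 * pi * real M / real N \<le> \<eta> / 4"
  shows "\<exists>b. 1 \<le> b \<and> b < q \<and>
    (\<forall>r\<in>spec (int q) f \<eta>. \<forall>j<M. norm (ee (int q) (r * (int b * int j)) - 1) \<le> \<eta> / 4)"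
proof -
  let ?R = "spec (int q) f \<eta>" and ?n = "nat \<lceil>1 / \<eta>^2\<rceil>"
  have q0: "int q > 0" "odd (int q)" using q by (auto intro: odd_pos)
  have "card ?R \<le> ?n"
    using card_spec_le[where f = f, OF q0 f01 \<eta>] real_nat_ceiling_ge[of "1 / \<eta>^2"] by linarith
  then have "N ^ card ?R \<le> N ^ ?n" using N by (intro power_increasing) auto
  then have lt: "real N ^ card ?R < real q" using N by (metis le_less_trans of_nat_less_iff of_nat_power)
  have "card (bohr (int q) ?R N) > 1"
  proof (rule ccontr)
    assume "\<not> ?thesis"
    then have "real (card (bohr (int q) ?R N)) * real N ^ card ?R \<le> 1 * real N ^ card ?R"
      by (intro mult_right_mono) auto
    then show False using card_bohr_ge[OF q0(1) finite_spec[of "int q" f \<eta>] N(1)] lt by simp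
  qed
  then have "\<not> bohr (int q) ?R N \<subseteq> {0}" using card_mono[of "{0::int}" "bohr (int q) ?R N"] by auto
  then obtain x where x: "x \<in> bohr (int q) ?R N" "x \<noteq> 0" by auto
  then have xr: "0 < x" "x < int q" by (auto simp: bohr_def)
  have "norm (ee (int q) (r * (x * int j)) - 1) \<le> \<eta> / 4" if r: "r \<in> ?R" and j: "j < M" for r j
  proof -
    have "norm (ee (int q) (int j * (r * x)) - 1) \<le> real j * norm (ee (int q) (r * x) - 1)"
      by (rule norm_ee_mult_le)
    also have "\<dots> \<le> real M * (2 * pi / real N)"
      using x(1) r j by (intro mult_mono) (auto simp: bohr_def)
    also have "\<dots> \<le> \<eta> / 4" using M by (simp add: mult_ac)
    finally show ?thesis by (simp add: mult_ac)
  qed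
  then show ?thesis using xr by (intro exI[of _ "nat x"]) auto
qed

section \<open>Minimisers at an index of fast growth\<close>

text \<open>Behrend's bound is exponential in this index, whereas by \<open>dens_diff_le\<close>
  lowering the index by \<open>n\<close> raises the density by a factor of only
  \<open>exp (n / sqrt i)\<close>.\<close>

definition dens :: "nat \<Rightarrow> real" where
  "dens i = exp (- sqrt (real i))"

lemma dens_le_1: "dens i \<le> 1"
  by (simp add: dens_def)

lemma dens_antimono: "i \<le> j \<Longrightarrow> dens j \<le> dens i"
  by (simp add: dens_def)

lemma dens_diff_le:
  assumes "0 < i" "n \<le> i"
  shows "dens (i - n) \<le> dens i * exp (real n / sqrt (real i))"
proof -
  let ?a = "sqrt (real i)" and ?b = "sqrt (real (i - n))"
  have a: "?a > 0" and b: "?b \<ge> 0" using assms by auto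
  have "(?a - ?b) * ?a \<le> (?a - ?b) * (?a + ?b)"
    using b by (intro mult_left_mono) auto
  also have "\<dots> = ?a^2 - ?b^2" by (simp add: power2_eq_square algebra_simps)
  also have "\<dots> = real n" using assms by (simp add: of_nat_diff)
  finally have "?a - ?b \<le> real n / ?a" using a by (simp add: field_simps)
  then show ?thesis by (simp add: dens_def flip: exp_add)
qed

text \<open>The weights \<open>2 * (1/2)^k\<close> from \<open>k = 2\<close> on sum to at most 1.
  Convexity of \<open>exp\<close> between 0 and the exponent at \<open>L = 2000\<close> makes the
  excess linear in \<open>1 / L\<close>, and its growth \<open>(3/2)^k\<close> is beaten by
  \<open>(1/2)^k\<close>.\<close>

lemma level_weights:
  fixes L :: real
  assumes L: "2000 \<le> L"
  shows "(\<Sum>k=2..K. 2 * (1/2)^k * exp (real (200 + 600 * k) / L)) \<le> 1 + 32000 / L"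
proof -
  have geo: "(\<Sum>k=2..K. (x::real)^k) \<le> x^2 / (1 - x)" if x: "0 < x" "x < 1" for x
  proof (cases "2 \<le> K")
    case True
    from sum_gp_multiplied[OF this, of x] have "(1 - x) * (\<Sum>k=2..K. x^k) \<le> x^2" using x by simp
    then show ?thesis using x by (simp add: field_simps)
  qed (use x in simp)
  have weight: "exp (real (200 + 600 * k) / L) \<le> 1 + 4000 / L * (3/2)^k" for k
  proof -
    let ?y = "real (200 + 600 * k) / 2000"
    have "exp ((1 - 2000 / L) *\<^sub>R 0 + (2000 / L) *\<^sub>R ?y) \<le> (1 - 2000 / L) * exp 0 + (2000 / L) * exp ?y"
      by (rule convex_onD[OF exp_convex]) (use L in auto)
    moreover have "(2000 / L) * ?y = real (200 + 600 * k) / L" using L by (simp add: field_simps)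
    ultimately have "exp (real (200 + 600 * k) / L) \<le> (1 - 2000 / L) + (2000 / L) * exp ?y" by simp
    also have "\<dots> \<le> 1 + (2000 / L) * exp ?y" using L by simp
    finally have *: "exp (real (200 + 600 * k) / L) \<le> 1 + (2000 / L) * exp ?y" .
    have "exp ?y = exp (1/10) * exp (3/10) ^ k"
      unfolding exp_of_nat_mult[symmetric] exp_add[symmetric] by simp
    also have "\<dots> \<le> 2 * (3/2)^k"
    proof (intro mult_mono power_mono)
      have "exp (1/10::real) \<le> 1 + 1/10 + (1/10)^2" by (rule exp_bound) auto
      also have "\<dots> \<le> 2" by (simp add: power2_eq_square)
      finally show "exp (1/10::real) \<le> 2" .
      have "exp (3/10::real) \<le> 1 + 3/10 + (3/10)^2" by (rule exp_bound) auto
      also have "\<dots> \<le> 3/2" by (simp add: power2_eq_square)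
      finally show "exp (3/10::real) \<le> 3/2" .
    qed auto
    finally have "(2000 / L) * exp ?y \<le> (2000 / L) * (2 * (3/2)^k)" using L by (intro mult_left_mono) auto
    with * show ?thesis by simp
  qed
  have "(\<Sum>k=2..K. 2 * (1/2)^k * exp (real (200 + 600 * k) / L)) \<le>
    (\<Sum>k=2..K. 2 * (1/2)^k * (1 + 4000 / L * (3/2)^k))"
    by (intro sum_mono mult_left_mono weight) auto
  also have "\<dots> = (\<Sum>k=2..K. 2 * (1/2)^k + 8000 / L * (3/4)^k)"
  proof (rule sum.cong[OF refl])
    fix k :: nat
    have "(1/2::real)^k * (3/2)^k = (3/4)^k" by (simp add: power_mult_distrib[symmetric])
    then show "2 * (1/2)^k * (1 + 4000 / L * (3/2)^k) = 2 * (1/2)^k + 8000 / L * (3/4)^k"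
      by (simp add: algebra_simps)
  qed
  also have "\<dots> = 2 * (\<Sum>k=2..K. (1/2)^k) + 8000 / L * (\<Sum>k=2..K. (3/4)^k)"
    by (simp add: sum.distrib sum_distrib_left)
  also have "\<dots> \<le> 2 * ((1/2)^2 / (1 - 1/2)) + 8000 / L * ((3/4)^2 / (1 - 3/4))"
    using L by (intro add_mono mult_left_mono geo) auto
  also have "\<dots> \<le> 1 + 32000 / L" using L by (simp add: power2_eq_square field_simps)
  finally show ?thesis .
qed

text \<open>A set of density \<open>dens j\<close> has at least \<open>exp ((i - j) / 280) r\<close> progressions, while a level set
  at height \<open>2\<^sup>-\<^sup>k\<close> has at most \<open>2 8\<^sup>k r\<close>; this limits its density to \<open>dens (i - 200 - 600 k)\<close>.\<close>
lemma level_set_size: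
  fixes q i k :: nat
  assumes q: "q > 0" and i: "0 < i" "200 + 600 * k \<le> i"
    and r: "r = r_min q (dens i)" "r > 0"
    and good: "\<And>j. j \<le> i \<Longrightarrow> r * exp (real (i - j) / 280) \<le> r_min q (dens j)"
    and g: "periodic (int q) g" "\<And>x. 0 \<le> g x" "T3 (int q) g \<le> 2 * r * real q ^ 2"
  shows "real (card {x. x < q \<and> (1/2)^k \<le> g (int x)}) \<le> dens i * real q * exp (real (200 + 600 * k) / sqrt (real i))"
proof -
  let ?n = "200 + 600 * k" and ?A = "{x. x < q \<and> (1/2)^k \<le> g (int x)}"
  have "real (card ?A) < dens (i - ?n) * real q"
  proof (rule ccontr)
    assume "\<not> ?thesis"
    then have "r_min q (dens (i - ?n)) \<le> mu q ?A" by (intro r_min_le) auto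
    then have "r * exp (real ?n / 280) \<le> mu q ?A" using good[of "i - ?n"] i by (simp add: of_nat_diff)
    then have "((1/2)^k)^3 * (r * exp (real ?n / 280) * real q ^ 2) \<le> ((1/2)^k)^3 * (mu q ?A * real q ^ 2)"
      by (intro mult_left_mono mult_right_mono) auto
    also have "\<dots> \<le> T3 (int q) g" by (rule T3_level_set[OF q g(1,2)]) simp
    also have "\<dots> \<le> 2 * r * real q ^ 2" by (rule g(3))
    finally have "(r * real q ^ 2) * (((1/2)^k)^3 * exp (real ?n / 280)) \<le> (r * real q ^ 2) * 2" by (simp add: mult_ac)
    then have "((1/2)^k)^3 * exp (real ?n / 280) \<le> 2"
      using r q by (subst (asm) mult_le_cancel_left_pos) auto
    then have "exp (real ?n / 280) \<le> 2 * (2^k)^3"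
      by (simp add: power_divide field_simps)
    also have "\<dots> = 2 ^ (1 + 3 * k)" by (simp add: power_mult[symmetric] mult.commute)
    also have "\<dots> = exp (real (1 + 3 * k) * ln 2)"
      unfolding exp_of_nat_mult by simp
    finally have "real ?n / 280 \<le> real (1 + 3 * k) * ln 2" by simp
    \<comment> \<open>The constants 200, 600 and 280 are matched to this comparison: 200/280 exceeds
      25/36 and 600/280 exceeds 3 * 25/36.\<close>
    also have "\<dots> \<le> real (1 + 3 * k) * (25 / 36)" by (intro mult_left_mono ln2_le_25_over_36) auto
    finally show False by simp
  qed
  also have "\<dots> \<le> dens i * exp (real ?n / sqrt (real i)) * real q"
    using dens_diff_le[OF i] by (intro mult_right_mono) auto
  finally show ?thesis by (simp add: mult_ac)
qed

text \<open>The condition \<open>2 * \<eta> \<le> r\<close> ensures that smoothing at most doubles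
  the progression count, as \<open>level_set_size\<close> expects. The bound on \<open>i\<close> is
  \<open>2000^2\<close>, so that \<open>level_weights\<close> applies with
  \<open>L = sqrt i\<close>.\<close>

lemma minimiser_almost_invariant:
  fixes q i M N :: nat
  assumes q: "odd q" and i: "4000000 \<le> i"
    and r: "r = r_min q (dens i)" and \<eta>: "0 < \<eta>" "2 * \<eta> \<le> r"
    and good: "\<And>j. j \<le> i \<Longrightarrow> r * exp (real (i - j) / 280) \<le> r_min q (dens j)"
    and N: "0 < N" "N ^ nat \<lceil>1 / \<eta>^2\<rceil> < q" and M: "0 < M" "2 * pi * real M / real N \<le> \<eta> / 4"
    and S: "S \<subseteq> {0..<q}" "dens i * real q \<le> real (card S)" "mu q S = r"
  shows "\<exists>b. 1 \<le> b \<and> b < q \<and> (\<forall>j. 2 * j \<le> M \<longrightarrow>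
    real (card S) * (1 - 130000 / sqrt (real i)) \<le> real (card (S \<inter> shift_mod q S (b * j))))"
proof -
  define L where "L = sqrt (real i)"
  have "2000^2 \<le> real i" using i by simp
  then have L: "2000 \<le> L" unfolding L_def by (rule real_le_rsqrt)
  have L2: "L * L = real i" by (simp add: L_def)
  have q0: "q > 0" "int q > 0" "odd (int q)" using q by (auto intro: odd_pos)
  obtain b where b: "1 \<le> b" "b < q"
    and close: "\<And>r j. r \<in> spec (int q) (ind q S) \<eta> \<Longrightarrow> j < M \<Longrightarrow>
      norm (ee (int q) (r * (int b * int j)) - 1) \<le> \<eta> / 4"
  proof -
    obtain b0 where "1 \<le> b0" "b0 < q"
      "\<forall>r\<in>spec (int q) (ind q S) \<eta>. \<forall>j<M. norm (ee (int q) (r * (int b0 * int j)) - 1) \<le> \<eta> / 4"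
      using exists_good_step[where f = "ind q S", OF q ind_01 \<eta>(1) N M(2)] by blast
    then show ?thesis using that by blast
  qed
  define g where "g = avg_shift {..<M} (\<lambda>j. int b * int j) (ind q S)"
  have g: "periodic (int q) g" unfolding g_def by (rule periodic_avg_shift[OF periodic_ind])
  have g01: "0 \<le> g x \<and> g x \<le> 1" for x unfolding g_def by (rule avg_shift_bounds[OF ind_01])
  have M': "finite {..<M}" "{..<M} \<noteq> {}" using M by (auto simp: lessThan_empty_iff)
  let ?s = "real (card S)"
  have sum_g: "(\<Sum>x\<in>{0..<int q}. g x) = ?s"
    unfolding g_def by (simp add: sum_avg_shift[OF q0(2) periodic_ind M'] sum_ind[OF S(1)])
  have "\<bar>T3 (int q) g - T3 (int q) (ind q S)\<bar> \<le> 2 * \<eta> * of_int (int q) ^ 2"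
    unfolding g_def
    by (rule smoothing[OF q0(2) periodic_ind ind_01 M'])
       (use \<eta> close in \<open>auto simp: spec_def\<close>)
  then have "T3 (int q) g \<le> (r + 2 * \<eta>) * real q ^ 2"
    using T3_ind[OF q0(1) S(1)] S(3) by (simp add: algebra_simps)
  also have "\<dots> \<le> 2 * r * real q ^ 2" using \<eta> by (intro mult_right_mono) auto
  finally have T3g: "T3 (int q) g \<le> 2 * r * real q ^ 2" .
  \<comment> \<open>Large enough that \<open>(1/2)^K\<close> is at most
    \<open>exp (- 2 * L)\<close>, negligible against the density \<open>exp (- L)\<close>; small
    enough that \<open>200 + 600 * k \<le> i\<close> for every \<open>k \<le> K\<close>.\<close>
  define K where "K = nat \<lceil>3 * L\<rceil>"
  have K: "3 * L \<le> real K" "real K \<le> 3 * L + 1" using L unfolding K_def by linarith+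
  have K1: "1 \<le> K" using K(1) L by linarith
  have level: "real (card {x. x < q \<and> (1/2)^k \<le> g (int x)}) \<le> ?s * exp (real (200 + 600 * k) / L)"
    if k: "k \<le> K" for k
  proof -
    have "real (200 + 600 * k) \<le> 200 + 600 * (3 * L + 1)" using k K(2) by simp
    also have "\<dots> \<le> 2000 * L" using L by simp
    also have "\<dots> \<le> L * L" using L by (intro mult_right_mono) auto
    finally have "200 + 600 * k \<le> i" unfolding L2 by simp
    then have "real (card {x. x < q \<and> (1/2)^k \<le> g (int x)}) \<le> dens i * real q * exp (real (200 + 600 * k) / L)"
      unfolding L_def using i \<eta> good T3g g01
      by (intro level_set_size[OF q0(1) _ _ r]) (auto intro: g)
    also have "\<dots> \<le> ?s * exp (real (200 + 600 * k) / L)"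
      using S(2) by (intro mult_right_mono) auto
    finally show ?thesis .
  qed
  have "(\<Sum>x<q. 2 * g (int x) - (g (int x))^2) \<le>
    (\<Sum>k=2..K. 2 * (1/2)^k * real (card {x. x < q \<and> (1/2)^k \<le> g (int x)})) + 2 * (1/2)^K * real q"
    by (rule energy_le_level_sets[OF g01 K1])
  also have "\<dots> \<le> (\<Sum>k=2..K. 2 * (1/2)^k * (?s * exp (real (200 + 600 * k) / L))) + ?s / L"
  proof (intro add_mono sum_mono mult_left_mono level)
    have "(1/2::real)^K = exp (- (real K * ln 2))"
      by (simp add: exp_minus exp_of_nat_mult power_divide field_simps)
    also have "\<dots> \<le> exp (- (2 * L))"
    proof -
      have "3 * L * (2/3) \<le> real K * ln 2" using K(1) L ln2_ge_two_thirds by (intro mult_mono) auto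
      then show ?thesis by simp
    qed
    also have "\<dots> = exp (- L) * exp (- L)" by (simp flip: exp_add)
    finally have "2 * (1/2)^K * real q \<le> (2 * exp (- L)) * (exp (- L) * real q)"
      using mult_right_mono[of "(1/2)^K" "exp (- L) * exp (- L)" "2 * real q"] by (simp add: mult_ac)
    also have "\<dots> \<le> (1 / L) * ?s"
    proof (intro mult_mono)
      have "0 \<le> ((L - 1)^2 + 1) / 2" by simp
      then have "2 * L \<le> 1 + L + L^2 / 2" by (simp add: power2_eq_square field_simps)
      also have "\<dots> \<le> exp L" using exp_lower_Taylor_quadratic[of L] L by simp
      finally show "2 * exp (- L) \<le> 1 / L" using L by (simp add: exp_minus field_simps)
      show "exp (- L) * real q \<le> ?s" using S(2) by (simp add: dens_def L_def)
    qed (use L in auto)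
    finally show "2 * (1/2)^K * real q \<le> ?s / L" by simp
  qed auto
  also have "(\<Sum>k=2..K. 2 * (1/2)^k * (?s * exp (real (200 + 600 * k) / L))) =
     ?s * (\<Sum>k=2..K. 2 * (1/2)^k * exp (real (200 + 600 * k) / L))"
    by (simp add: sum_distrib_left mult_ac)
  also have "\<dots> \<le> ?s * (1 + 32000 / L)"
    by (intro mult_left_mono level_weights L) auto
  finally have "2 * (\<Sum>x\<in>{0..<int q}. g x) - (\<Sum>x\<in>{0..<int q}. (g x)^2) \<le> ?s * (1 + 32000 / L) + ?s / L"
    by (simp add: sum_int_interval sum_subtractf sum_distrib_left atLeast0LessThan)
  \<comment> \<open>As \<open>g\<close> has the same sum as \<open>S\<close>, the bound on the sum
    of \<open>2 * g - g^2\<close> becomes a bound on the energy deficit. Multiplied by 4 it stays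
    below 130000.\<close>
  then have energy: "?s - (\<Sum>x\<in>{0..<int q}. (g x)^2) \<le> 32001 * (?s / L)"
    unfolding sum_g by (simp add: algebra_simps)
  have "?s * (1 - 130000 / sqrt (real i)) \<le> real (card (S \<inter> shift_mod q S (b * j)))" if j: "2 * j \<le> M" for j
  proof -
    have "?s * (1 - 130000 / L) \<le> ?s - 4 * (32001 * (?s / L))"
      using L by (simp add: field_simps)
    also have "\<dots> \<le> ?s - 4 * (?s - (\<Sum>x\<in>{0..<int q}. (g x)^2))" using energy by argo
    also have "\<dots> \<le> (\<Sum>x\<in>{0..<int q}. ind q S x * ind q S (x + int b * int j))"
      unfolding g_def by (rule translation_invariance[OF q0(1) S(1) M(1) j])
    also have "\<dots> = real (card (S \<inter> shift_mod q S (b * j)))"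
      using card_shift_mod[OF q0(1) S(1), of "b * j"] by simp
    finally show ?thesis unfolding L_def .
  qed
  then show ?thesis using b by blast
qed

section \<open>Bounds for \<open>r_min\<close> and the choice of index and progression
  length\<close>

lemma r_min_roth:
  assumes \<rho>: "0 < \<rho>" "\<rho> \<le> 1"
  shows "\<exists>m>0. \<forall>q \<rho>'. odd q \<longrightarrow> \<rho> \<le> \<rho>' \<longrightarrow> \<rho>' \<le> 1 \<longrightarrow> m \<le> r_min q \<rho>'"
proof -
  obtain m where m: "m > 0" and roth: "\<And>q f. 0 < q \<Longrightarrow> odd q \<Longrightarrow> periodic q f \<Longrightarrow>
      (\<And>x. 0 \<le> f x \<and> f x \<le> 1) \<Longrightarrow> \<rho> * of_int q \<le> (\<Sum>x\<in>{0..<q}. f x) \<Longrightarrow> m * of_int q ^ 2 \<le> T3 q f"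
    using roth_varnavides[OF \<rho>] by blast
  have "m \<le> r_min q \<rho>'" if q: "odd q" and \<rho>': "\<rho> \<le> \<rho>'" "\<rho>' \<le> 1" for q \<rho>'
  proof (rule r_min_ge[OF \<rho>'(2)])
    fix S assume S: "S \<subseteq> {0..<q}" "\<rho>' * real q \<le> real (card S)"
    have q0: "q > 0" using q by (rule odd_pos)
    have "\<rho> * real q \<le> \<rho>' * real q" using \<rho>' by (intro mult_right_mono) auto
    then have "\<rho> * of_int (int q) \<le> (\<Sum>x\<in>{0..<int q}. ind q S x)" using S by (simp add: sum_ind)
    then have "m * of_int (int q) ^ 2 \<le> T3 (int q) (ind q S)"
      using q q0 by (intro roth periodic_ind ind_01) auto
    then show "m \<le> mu q S" using q0 by (simp add: T3_ind S(1))
  qed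
  then show ?thesis using m by blast
qed

text \<open>\<open>behrend_mod\<close> with \<open>k\<close> about \<open>sqrt i / 5\<close>: then
  \<open>2 ^ (7 * k) \<le> exp (sqrt i)\<close>, while \<open>k \<ge> sqrt i / 6\<close> and
  \<open>ln 2 \<ge> 2/3\<close> give the exponent \<open>i / 54\<close>. The bound on
  \<open>i\<close> is \<open>30^2\<close>, which lets the floor stay above
  \<open>sqrt i / 6\<close>.\<close>

lemma r_min_behrend:
  assumes i: "900 \<le> i"
  shows "\<exists>Q. \<forall>q\<ge>Q. r_min q (dens i) \<le> exp (- real i / 54)"
proof -
  define L where "L = sqrt (real i)"
  have "30^2 \<le> real i" using i by simp
  then have L: "30 \<le> L" unfolding L_def by (rule real_le_rsqrt)
  have L2: "L * L = real i" by (simp add: L_def)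
  define k where "k = nat \<lfloor>L / 5\<rfloor>"
  have k: "real k \<le> L / 5" "L / 6 \<le> real k" "k > 0" using L unfolding k_def by linarith+
  have "r_min q (dens i) \<le> exp (- real i / 54)" if q: "4 * 2 ^ (k * (k + 1)) \<le> q" for q
  proof -
    obtain S where S: "S \<subseteq> {0..<q}" "real q \<le> real (card S) * 2 ^ (7 * k)" "mu q S * 2 ^ (k * k) \<le> 1"
      using behrend_mod[OF k(3) q] by blast
    have pow: "(2::real) ^ n = exp (real n * ln 2)" for n by (simp add: exp_of_nat_mult)
    have "real (7 * k) * ln 2 \<le> (7 * (L / 5)) * (25 / 36)"
      using k ln2_le_25_over_36 by (intro mult_mono) auto
    also have "\<dots> \<le> L" using L by simp
    finally have "2 ^ (7 * k) \<le> exp L" unfolding pow by simp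
    then have "real q \<le> real (card S) * exp L"
      using S(2) by (meson mult_left_mono of_nat_0_le_iff order_trans)
    then have "dens i * real q \<le> real (card S)"
      by (simp add: dens_def L_def[symmetric] exp_minus field_simps)
    then have "r_min q (dens i) \<le> mu q S" by (rule r_min_le[OF S(1)])
    also have "\<dots> \<le> exp (- (real (k * k) * ln 2))"
      using S(3) unfolding pow by (simp add: exp_minus field_simps)
    also have "\<dots> \<le> exp (- real i / 54)"
    proof -
      have "(L / 6) * (L / 6) * (2 / 3) \<le> real k * real k * ln 2"
        using k L ln2_ge_two_thirds by (intro mult_mono) auto
      then show ?thesis using L2 by simp
    qed
    finally show ?thesis .
  qed
  then show ?thesis by blast
qed

text \<open>Minimality of \<open>i\<close> for \<open>r_min q (dens j) exp (j / 280)\<close> is the growth condition of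
  \<open>minimiser_almost_invariant\<close>. Behrend's bound makes the weight at \<open>I\<close> smaller than
  Varnavides' lower bound for \<open>j \<le> i0\<close>, which forces \<open>i > i0\<close>.\<close>
lemma exists_good_index:
  fixes i0 I q :: nat
  assumes low: "\<And>j. j \<le> i0 \<Longrightarrow> m \<le> r_min q (dens j)" and m: "0 < m"
    and I: "- ln m * 280 < real I" and high: "r_min q (dens I) \<le> exp (- real I / 54)"
  shows "\<exists>i. i0 < i \<and> i \<le> I \<and> (\<forall>j\<le>i. r_min q (dens i) * exp (real (i - j) / 280) \<le> r_min q (dens j))"
proof -
  define w where "w j = r_min q (dens j) * exp (real j / 280)" for j
  have "{..I} \<noteq> {}" by simp
  then obtain i where i: "i \<le> I" "\<And>j. j \<le> I \<Longrightarrow> w i \<le> w j"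
    using arg_min_least[of "{..I}" _ w] arg_min_if_finite(1)[of "{..I}" w] by (metis atMost_iff finite_atMost)
  have "w I \<le> exp (- real I / 54) * exp (real I / 280)"
    unfolding w_def using high by (intro mult_right_mono) auto
  also have "\<dots> = exp (- real I / 54 + real I / 280)" by (simp only: exp_add)
  \<comment> \<open>The growth rate 1/280 is less than half of Behrend's rate 1/54.\<close>
  also have "\<dots> \<le> exp (- (real I / 280))" by simp
  also have "\<dots> < m"
  proof -
    have "- (real I / 280) < ln m" using I by simp
    then show ?thesis using m by (metis exp_less_cancel_iff exp_ln)
  qed
  finally have wI: "w I < m" .
  have "i0 < i"
  proof (rule ccontr)
    assume "\<not> i0 < i"
    then have "m \<le> r_min q (dens i)" by (intro low) simp
    also have "\<dots> \<le> w i"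
      using \<open>m \<le> r_min q (dens i)\<close> m unfolding w_def by (intro mult_right_le_one_le[THEN order.trans] mult_le_cancel_left1[THEN iffD2]) auto
    also have "\<dots> \<le> w I" by (rule i(2)) simp
    finally show False using wI by simp
  qed
  moreover have "r_min q (dens i) * exp (real (i - j) / 280) \<le> r_min q (dens j)" if j: "j \<le> i" for j
  proof -
    have "w i \<le> w j" using i j by (intro i(2)) simp
    moreover have "exp (real i / 280) = exp (real (i - j) / 280) * exp (real j / 280)"
      using j by (simp add: of_nat_diff diff_divide_distrib flip: exp_add)
    ultimately show ?thesis by (simp add: w_def)
  qed
  ultimately show ?thesis using i(1) by blast
qed

text \<open>\<open>M\<close> is about twice \<open>q powr d\<close> and \<open>N\<close> a fixed
  multiple of \<open>M\<close>. The exponent is chosen so that \<open>d * n \<le> 1/2\<close>; then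
  \<open>N ^ n\<close> is at most a constant times \<open>sqrt q\<close>, which is below
  \<open>q\<close> for large \<open>q\<close>.\<close>

lemma exists_progression_length:
  fixes \<eta> :: real
  assumes \<eta>: "0 < \<eta>"
  defines "n \<equiv> nat \<lceil>1 / \<eta>^2\<rceil>"
  shows "\<exists>Q. \<forall>q\<ge>Q. \<exists>M N. 0 < M \<and> 0 < N \<and> N ^ n < q \<and> 2 * pi * real M / real N \<le> \<eta> / 4 \<and>
    (\<forall>j. real j \<le> real q powr (1 / (2 * (real n + 1))) \<longrightarrow> 2 * j \<le> M)"
proof -
  define d where "d = 1 / (2 * (real n + 1))"
  \<comment> \<open>78 is 26 times the 3 in \<open>M \<le> 3 * Y\<close>, and the added 1 absorbs
    the rounding of \<open>N\<close>.\<close>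
  define C where "C = 78 / \<eta> + 1"
  have C: "C \<ge> 1" using \<eta> by (simp add: C_def)
  have "\<exists>M N. 0 < M \<and> 0 < N \<and> N ^ n < q \<and> 2 * pi * real M / real N \<le> \<eta> / 4 \<and>
    (\<forall>j. real j \<le> real q powr d \<longrightarrow> 2 * j \<le> M)"
    if q: "nat \<lceil>C ^ (2 * n)\<rceil> + 1 \<le> q" for q
  proof -
    have qC: "C ^ (2 * n) < real q" using q by linarith
    have q1: "1 \<le> real q" using q by simp
    define Y where "Y = real q powr d"
    have Y: "1 \<le> Y" unfolding Y_def d_def using q1 by (intro ge_one_powr_ge_zero) auto
    define M where "M = 2 * nat \<lfloor>Y\<rfloor> + 1"
    have M: "real M \<le> 3 * Y" using Y unfolding M_def by linarith
    define N where "N = nat \<lceil>26 * real M / \<eta>\<rceil>"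
    have N1: "26 * real M / \<eta> \<le> real N" unfolding N_def by (rule real_nat_ceiling_ge)
    have pos: "0 < 26 * real M / \<eta>" using \<eta> by (simp add: M_def)
    have N0: "0 < real N" using N1 pos by linarith
    have "real N \<le> 26 * real M / \<eta> + 1" unfolding N_def using pos by linarith
    also have "\<dots> \<le> 26 * (3 * Y) / \<eta> + Y" using M Y \<eta> by (intro add_mono divide_right_mono) auto
    also have "\<dots> = C * Y" by (simp add: C_def algebra_simps)
    finally have "real N ^ n \<le> (C * Y) ^ n" by (intro power_mono) auto
    also have "\<dots> = C ^ n * Y ^ n" by (simp add: power_mult_distrib)
    also have "Y ^ n = real q powr (d * real n)"
      using q1 by (simp add: Y_def powr_powr flip: powr_realpow)
    also have "\<dots> \<le> real q powr (1 / 2)"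
      using q1 by (intro powr_mono) (simp_all add: d_def field_simps)
    also have "real q powr (1 / 2) = sqrt (real q)" by (simp add: powr_half_sqrt)
    finally have "real N ^ n \<le> C ^ n * sqrt (real q)" using C by (simp add: mult_left_mono)
    also have "\<dots> < sqrt (real q) * sqrt (real q)"
    proof (intro mult_strict_right_mono)
      have "(C ^ n)^2 < real q" using qC by (simp add: mult.commute flip: power_mult)
      then show "C ^ n < sqrt (real q)" by (rule real_less_rsqrt)
    qed (use q1 in simp)
    also have "\<dots> = real q" by simp
    finally have "N ^ n < q" by (metis of_nat_less_iff of_nat_power)
    moreover have "2 * pi * real M / real N \<le> \<eta> / 4"
    proof -
      have "8 * pi * real M \<le> 26 * real M" using pi_approx by (intro mult_right_mono) auto
      also have "\<dots> \<le> real N * \<eta>" using N1 \<eta> by (simp add: field_simps)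
      finally show ?thesis using N0 by (simp add: field_simps)
    qed
    moreover have "2 * j \<le> M" if "real j \<le> real q powr d" for j
      using that unfolding Y_def[symmetric] M_def by linarith
    ultimately show ?thesis using N0 by (intro exI[of _ M] exI[of _ N]) (auto simp: M_def)
  qed
  then show ?thesis unfolding d_def by blast
qed

text \<open>The parameters are fixed in the order \<open>i0\<close>, \<open>I\<close>,
  \<open>\<eta>\<close>, \<open>d\<close>, all before \<open>q\<close>, which is what permits the
  pigeonhole over the indices between \<open>i0\<close> and \<open>I\<close>.\<close>

theorem theorem3:
  assumes H: "\<forall>\<theta>::real. \<theta> > 0 \<longrightarrow> (\<exists>x0::real. \<forall>x::real. x \<ge> x0 \<longrightarrow>
                 (\<exists>p::nat. prime p \<and> x \<le> real p \<and> real p \<le> x + x powr \<theta>))"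
  shows "\<exists>c::real. c > 0 \<and>
    (\<forall>\<rho>0::real. 0 < \<rho>0 \<and> \<rho>0 < 1 \<longrightarrow>
      (\<exists>\<rho>1 d::real. 0 < \<rho>1 \<and> \<rho>1 < \<rho>0 \<and> 0 < d \<and> d < 1 \<and>
         infinite {q::nat. prime q \<and>
           (\<forall>S. S \<subseteq> {0..<q} \<and> real (card S) \<ge> \<rho>1 * real q \<and> mu q S = r_min q \<rho>1 \<longrightarrow>
              (\<exists>b::nat. 1 \<le> b \<and> b \<le> q - 1 \<and>
                 (\<forall>j::nat. real j \<le> real q powr d \<longrightarrow>
                    real (card (S \<inter> shift_mod q S (b * j)))
                      \<ge> real (card S) * (1 - c / \<bar>ln \<rho>1\<bar>))))}))"
proof (rule exI[of _ "130000::real"], intro conjI allI impI)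
  fix \<rho>0 :: real assume \<rho>0: "0 < \<rho>0 \<and> \<rho>0 < 1"
  \<comment> \<open>The first summand meets the threshold of
    \<open>minimiser_almost_invariant\<close>; the second makes every later density smaller than
    \<open>\<rho>0\<close>.\<close>
  define i0 where "i0 = 4000000 + nat \<lceil>(ln \<rho>0)^2\<rceil>"
  have dens_small: "dens i < \<rho>0" if "i0 < i" for i
  proof -
    have "(ln \<rho>0)^2 < real i" using that unfolding i0_def by linarith
    then have "\<bar>ln \<rho>0\<bar> < sqrt (real i)" by (intro real_less_rsqrt) simp
    then have "- sqrt (real i) < ln \<rho>0" by linarith
    then show ?thesis using \<rho>0 unfolding dens_def by (metis exp_less_cancel_iff exp_ln)
  qed
  have dens_pos: "0 < dens i" for i by (simp add: dens_def)
  obtain m0 where m0: "0 < m0" and low: "\<And>q \<rho>. odd q \<Longrightarrow> dens i0 \<le> \<rho> \<Longrightarrow> \<rho> \<le> 1 \<Longrightarrow> m0 \<le> r_min q \<rho>"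
    using r_min_roth[OF dens_pos dens_le_1, of i0] by blast
  define I where "I = i0 + nat \<lceil>\<bar>ln m0\<bar> * 280\<rceil> + 1"
  have I: "- ln m0 * 280 < real I" "900 \<le> I" unfolding I_def i0_def by linarith+
  obtain Q1 where Q1: "\<And>q. Q1 \<le> q \<Longrightarrow> r_min q (dens I) \<le> exp (- real I / 54)"
    using r_min_behrend[OF I(2)] by blast
  obtain m1 where m1: "0 < m1" and lower: "\<And>q \<rho>. odd q \<Longrightarrow> dens I \<le> \<rho> \<Longrightarrow> \<rho> \<le> 1 \<Longrightarrow> m1 \<le> r_min q \<rho>"
    using r_min_roth[OF dens_pos dens_le_1, of I] by blast
  \<comment> \<open>\<open>m1\<close> bounds \<open>r_min\<close> from below at all indices up to
    \<open>I\<close>, so this one \<open>\<eta>\<close> serves whichever index the pigeonhole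
    selects.\<close>
  define \<eta> where "\<eta> = m1 / 2"
  have \<eta>: "0 < \<eta>" using m1 by (simp add: \<eta>_def)
  define n where "n = nat \<lceil>1 / \<eta>^2\<rceil>"
  define d where "d = 1 / (2 * (real n + 1))"
  obtain Q2 where Q2: "\<And>q. Q2 \<le> q \<Longrightarrow> \<exists>M N. 0 < M \<and> 0 < N \<and> N ^ n < q \<and> 2 * pi * real M / real N \<le> \<eta> / 4 \<and>
      (\<forall>j. real j \<le> real q powr d \<longrightarrow> 2 * j \<le> M)"
    using exists_progression_length[OF \<eta>] unfolding n_def d_def by blast
  define good where "good q i \<longleftrightarrow> (\<forall>j\<le>i. r_min q (dens i) * exp (real (i - j) / 280) \<le> r_min q (dens j))" for q i
  let ?P = "{q. prime q \<and> 2 < q \<and> Q1 \<le> q \<and> Q2 \<le> q}"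
  have "infinite ?P"
  proof -
    have "infinite {q::nat. prime q}" by (rule primes_infinite)
    moreover have "{q. prime q} \<subseteq> ?P \<union> {..2 + Q1 + Q2}" by auto
    ultimately show ?thesis by (meson finite_UnI finite_atMost finite_subset)
  qed
  moreover have "?P \<subseteq> (\<Union>i\<in>{i0<..I}. {q \<in> ?P. good q i})"
  proof
    fix q assume q: "q \<in> ?P"
    then have "odd q" using prime_odd_nat by auto
    then have "m0 \<le> r_min q (dens j)" if "j \<le> i0" for j
      using that by (intro low dens_antimono dens_le_1)
    moreover have "r_min q (dens I) \<le> exp (- real I / 54)" using q by (intro Q1) simp
    ultimately obtain i where "i0 < i" "i \<le> I" "good q i"
      unfolding good_def using exists_good_index[of i0 m0 q I] m0 I(1) by blast
    then show "q \<in> (\<Union>i\<in>{i0<..I}. {q \<in> ?P. good q i})" using q by auto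
  qed
  ultimately obtain i where i: "i0 < i" "i \<le> I" and inf: "infinite {q \<in> ?P. good q i}"
    by (metis (no_types, lifting) finite_UN_I finite_greaterThanAtMost greaterThanAtMost_iff infinite_super)
  have "{q \<in> ?P. good q i} \<subseteq> {q. prime q \<and>
           (\<forall>S. S \<subseteq> {0..<q} \<and> real (card S) \<ge> dens i * real q \<and> mu q S = r_min q (dens i) \<longrightarrow>
              (\<exists>b::nat. 1 \<le> b \<and> b \<le> q - 1 \<and>
                 (\<forall>j::nat. real j \<le> real q powr d \<longrightarrow>
                    real (card (S \<inter> shift_mod q S (b * j)))
                      \<ge> real (card S) * (1 - 130000 / \<bar>ln (dens i)\<bar>))))}"
  proof (intro subsetI CollectI conjI allI impI)
    fix q S assume q: "q \<in> {q \<in> ?P. good q i}"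
      and S: "S \<subseteq> {0..<q} \<and> real (card S) \<ge> dens i * real q \<and> mu q S = r_min q (dens i)"
    then have "odd q" using prime_odd_nat by auto
    obtain M N where M: "0 < M" "2 * pi * real M / real N \<le> \<eta> / 4" and N: "0 < N" "N ^ n < q"
      and t: "\<And>j. real j \<le> real q powr d \<Longrightarrow> 2 * j \<le> M"
      using Q2[of q] q by auto
    have "m1 \<le> r_min q (dens i)"
      by (intro lower \<open>odd q\<close> dens_le_1 dens_antimono i)
    then have "2 * \<eta> \<le> r_min q (dens i)" by (simp add: \<eta>_def)
    moreover have "4000000 \<le> i" using i(1) by (simp add: i0_def)
    ultimately obtain b where b: "1 \<le> b" "b < q"
      "\<And>j. 2 * j \<le> M \<Longrightarrow> real (card S) * (1 - 130000 / sqrt (real i)) \<le> real (card (S \<inter> shift_mod q S (b * j)))"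
      using minimiser_almost_invariant[OF \<open>odd q\<close> _ refl \<eta> _ _ N[unfolded n_def] M, of i S] q S
      unfolding good_def by blast
    have "\<bar>ln (dens i)\<bar> = sqrt (real i)" by (simp add: dens_def)
    then show "\<exists>b::nat. 1 \<le> b \<and> b \<le> q - 1 \<and>
                 (\<forall>j::nat. real j \<le> real q powr d \<longrightarrow>
                    real (card (S \<inter> shift_mod q S (b * j)))
                      \<ge> real (card S) * (1 - 130000 / \<bar>ln (dens i)\<bar>))"
      using b t by (intro exI[of _ b]) auto
  qed auto
  then have "infinite {q. prime q \<and>
           (\<forall>S. S \<subseteq> {0..<q} \<and> real (card S) \<ge> dens i * real q \<and> mu q S = r_min q (dens i) \<longrightarrow>
              (\<exists>b::nat. 1 \<le> b \<and> b \<le> q - 1 \<and>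
                 (\<forall>j::nat. real j \<le> real q powr d \<longrightarrow>
                    real (card (S \<inter> shift_mod q S (b * j)))
                      \<ge> real (card S) * (1 - 130000 / \<bar>ln (dens i)\<bar>))))}"
    using inf by (rule infinite_super)
  moreover have "0 < d" "d < 1" by (simp_all add: d_def)
  ultimately show "\<exists>\<rho>1 d::real. 0 < \<rho>1 \<and> \<rho>1 < \<rho>0 \<and> 0 < d \<and> d < 1 \<and>
         infinite {q::nat. prime q \<and>
           (\<forall>S. S \<subseteq> {0..<q} \<and> real (card S) \<ge> \<rho>1 * real q \<and> mu q S = r_min q \<rho>1 \<longrightarrow>
              (\<exists>b::nat. 1 \<le> b \<and> b \<le> q - 1 \<and>
                 (\<forall>j::nat. real j \<le> real q powr d \<longrightarrow>
                    real (card (S \<inter> shift_mod q S (b * j)))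
                      \<ge> real (card S) * (1 - 130000 / \<bar>ln \<rho>1\<bar>))))}"
    using dens_pos[of i] dens_small[OF i(1)] by blast
qed simp

end
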